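(* Consider a scalar system $x_{t+1}=Ax_t+B_uu_t+B_ww_t$ with $A,B_u,B_w,Q\in\mathbb R$ and per-step cost $Qx_t^2+u_t^2$, where $Q>0$, $(A,B_u)$ is stabilizable and $B_w\neq0$. With the notation of the context, the optimal competitive ratio is $$\text{Comp-Ratio}=\inf_{\mathcal K\text{ strictly causal}}\ \sup_{\mathbf w}\frac{\mathrm{cost}(\mathcal K,\mathbf w)}{\mathrm{cost}(\mathcal K_0,\mathbf w)}=1+\frac{B_u^2P^2(Q^{-1}+P)}{1+B_u^2P}.$$ Moreover, the competitive-ratio optimal controller is $$u_t=-K_{\text{lqr}}x_t.$$ In other words, for scalar systems, the $\mathcal H_2$ (LQR) controller with state-feedback law attains the optimal competitive ratio.
   Context: Time runs over all integers; all quantities $x_t,u_t,w_t$ are real scalars. The disturbance $\mathbf w=\{w_t\}$ is in $\ell_2$ (nonzero when it appears in a ratio). Let $\mathcal F,\mathcal G$ be the causal time-invariant doubly infinite Toeplitz operators with Markov parameters $Q^{1/2}A^{i-1}B_u$ and $Q^{1/2}A^{i-1}B_w$, $i>0$, i.e. with transfer functions $F(z)=Q^{1/2}(z-A)^{-1}B_u$ and $G(z)=Q^{1/2}(z-A)^{-1}B_w$; thus $\{Q^{1/2}x_t\}=\mathcal F\mathbf u+\mathcal G\mathbf w$. It is assumed that $G(e^{j\omega})$ has full column rank for all $\omega$. A strictly causal (linear) controller is a linear map $\mathbf u=\mathcal K\mathbf w$ such that $u_t$ depends only on $\{w_i\}_{i<t}$. Its cost is $$\mathrm{cost}(\mathcal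 K,\mathbf w)=\sum_{t\in\mathbb Z}(Qx_t^2+u_t^2)=\mathbf w^*T_{\mathcal K}^*T_{\mathcal K}\mathbf w,\qquad T_{\mathcal K}=\begin{bmatrix}\mathcal F\mathcal K+\mathcal G\\ \mathcal K\end{bmatrix}.$$ The optimal non-causal (clairvoyant) controller is $\mathcal K_0=-(I+\mathcal F^*\mathcal F)^{-1}\mathcal F^*\mathcal G$, with $T_{\mathcal K_0}^*T_{\mathcal K_0}=\mathcal G^*(I+\mathcal F\mathcal F^* )^{-1}\mathcal G$. $P$ is the stabilizing solution of the LQR Riccati equation $P=A^2P+Q-K_{\text{lqr}}^2(1+B_u^2P)$ with $K_{\text{lqr}}=(1+B_u^2P)^{-1}B_uPA$ (stabilizing: $|A-B_uK_{\text{lqr}}|<1$).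
   Formalization: The printed value is false (A=0, B_u=B_w=1, Q=2: P=2, the ratio is at most 3, but the formula gives 13/3); the P inside (Q^{-1}+P) is replaced by B_u^2 P/Q, so the optimal competitive ratio proved is 1+B_u^2P^2/Q. *)

theory Defs
  imports "HOL-Analysis.Analysis"
begin

type_synonym signal = "int \<Rightarrow> real"

definition l2 :: "signal set" where
  "l2 = {w. (\<lambda>t. (w t)\<^sup>2) summable_on UNIV}"

text \<open>
  \<open>plant_op A B Q\<close> is the strictly causal doubly infinite Toeplitz operator with Markov
  parameters \<open>Q\<^sup>1\<^sup>/\<^sup>2 A\<^sup>i\<^sup>-\<^sup>1 B\<close> for \<open>i > 0\<close>, and \<open>plant_tf A B Q\<close> is its transfer function. The
  operators \<open>F\<close> and \<open>G\<close> are obtained for \<open>B = B\<^sub>u\<close> and \<open>B = B\<^sub>w\<close>. If \<open>\<bar>A\<bar> \<ge> 1\<close> the series need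
  not converge for an arbitrary square-summable signal; it is applied below to
  signals starting at a finite time, and to signals decaying fast enough at \<open>-\<infinity>\<close>.
\<close>

definition plant_op :: "real \<Rightarrow> real \<Rightarrow> real \<Rightarrow> signal \<Rightarrow> signal" where
  "plant_op A B Q u t = (\<Sum>i. sqrt Q * A ^ i * B * u (t - 1 - int i))"

definition plant_tf :: "real \<Rightarrow> real \<Rightarrow> real \<Rightarrow> complex \<Rightarrow> complex" where
  "plant_tf A B Q z = of_real (sqrt Q) * inverse (z - of_real A) * of_real B"

definition start_at :: "nat \<Rightarrow> signal \<Rightarrow> signal" where
  "start_at N w t = (if - int N \<le> t then w t else 0)"

text \<open>
  \<open>x\<close> is the state trajectory for the disturbance \<open>w\<close> and the control \<open>u = K w\<close>. The
  recursion on all of \<open>\<int>\<close> leaves one degree of freedom, which is fixed by the second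
  conjunct, i.e. by \<open>Q\<^sup>1\<^sup>/\<^sup>2 x = (F K + G) w\<close>. For \<open>\<bar>A\<bar> \<ge> 1\<close> the two terms of this sum need
  not exist separately, so \<open>F K + G\<close> is evaluated as the limit of its values on
  disturbances that start at time \<open>-N\<close>. The recursion alone, restricted to
  square-summable \<open>x\<close>, would not do: for \<open>\<bar>A\<bar> > 1\<close> it has the anticausal solution.
\<close>

definition state_trajectory ::
  "real \<Rightarrow> real \<Rightarrow> real \<Rightarrow> real \<Rightarrow> (signal \<Rightarrow> signal) \<Rightarrow> signal \<Rightarrow> signal \<Rightarrow> bool" where
  "state_trajectory A Bu Bw Q K w x \<longleftrightarrow>
     (\<forall>t. x (t + 1) = A * x t + Bu * K w t + Bw * w t) \<and>
     (\<forall>t. (\<lambda>N. plant_op A Bu Q (K (start_at N w)) t + plant_op A Bw Q (start_at N w) t)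
            \<longlonglongrightarrow> sqrt Q * x t)"

text \<open>
  For \<open>Q > 0\<close> there is at most one state trajectory, so the infimum only selects it;
  the cost is \<open>\<infinity>\<close> if there is none.
\<close>

definition cost ::
  "real \<Rightarrow> real \<Rightarrow> real \<Rightarrow> real \<Rightarrow> (signal \<Rightarrow> signal) \<Rightarrow> signal \<Rightarrow> ennreal" where
  "cost A Bu Bw Q K w =
     (INF x \<in> {x. state_trajectory A Bu Bw Q K w x}.
        \<Sum>\<^sub>\<infinity>t\<in>UNIV. ennreal (Q * (x t)\<^sup>2 + (K w t)\<^sup>2))"

definition strictly_causal_controllers :: "(signal \<Rightarrow> signal) set" where
  "strictly_causal_controllers = {K.
     (\<forall>v\<in>l2. \<forall>w\<in>l2. \<forall>a b t. K (\<lambda>s. a * v s + b * w s) t = a * K v t + b * K w t) \<and>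
     (\<forall>v\<in>l2. \<forall>w\<in>l2. \<forall>t. (\<forall>i<t. v i = w i) \<longrightarrow> K v t = K w t)}"

text \<open>
  The bi-infinite Toeplitz operator with symbol \<open>a\<close> on the unit circle. As in
  \<open>F(z) = \<Sum>\<^sub>i F\<^sub>i z\<^sup>-\<^sup>i\<close>, the entry on the diagonal \<open>n = t - s\<close> is the coefficient of \<open>z\<^sup>-\<^sup>n\<close>.
  Adjoints correspond to complex conjugate symbols. Taking real parts is harmless
  for the symbol used below, whose coefficients are real.
\<close>

definition laurent_coeff :: "(complex \<Rightarrow> complex) \<Rightarrow> int \<Rightarrow> real" where
  "laurent_coeff a n =
     Re (integral {0..2 * pi} (\<lambda>\<theta>. a (cis \<theta>) * cis (of_int n * \<theta>))) / (2 * pi)"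

definition laurent_op :: "(complex \<Rightarrow> complex) \<Rightarrow> signal \<Rightarrow> signal" where
  "laurent_op a w t = (\<Sum>\<^sub>\<infinity>s\<in>UNIV. laurent_coeff a (t - s) * w s)"

text \<open>
  The non-causal controller \<open>K\<^sub>0 = -(I + F\<^sup>* F)\<^sup>-\<^sup>1 F\<^sup>* G\<close>. It is given by its symbol because it
  is a bounded operator even where \<open>F\<close> and \<open>G\<close> are not (\<open>\<bar>A\<bar> \<ge> 1\<close>).
\<close>

definition clairvoyant :: "real \<Rightarrow> real \<Rightarrow> real \<Rightarrow> real \<Rightarrow> signal \<Rightarrow> signal" where
  "clairvoyant A Bu Bw Q =
     laurent_op (\<lambda>z. - inverse (1 + cnj (plant_tf A Bu Q z) * plant_tf A Bu Q z)
                      * cnj (plant_tf A Bu Q z) * plant_tf A Bw Q z)"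

definition worst_case_ratio ::
  "real \<Rightarrow> real \<Rightarrow> real \<Rightarrow> real \<Rightarrow> (signal \<Rightarrow> signal) \<Rightarrow> ennreal" where
  "worst_case_ratio A Bu Bw Q K =
     (SUP w \<in> l2 - {\<lambda>t. 0}. cost A Bu Bw Q K w / cost A Bu Bw Q (clairvoyant A Bu Bw Q) w)"

definition comp_ratio :: "real \<Rightarrow> real \<Rightarrow> real \<Rightarrow> real \<Rightarrow> ennreal" where
  "comp_ratio A Bu Bw Q = (INF K \<in> strictly_causal_controllers. worst_case_ratio A Bu Bw Q K)"

definition stabilizable :: "real \<Rightarrow> real \<Rightarrow> bool" where
  "stabilizable A B \<longleftrightarrow> (\<exists>k. \<bar>A - B * k\<bar> < 1)"

definition lqr_gain :: "real \<Rightarrow> real \<Rightarrow> real \<Rightarrow> real" where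
  "lqr_gain A Bu P = inverse (1 + Bu\<^sup>2 * P) * Bu * P * A"

definition stabilizing_riccati_solution :: "real \<Rightarrow> real \<Rightarrow> real \<Rightarrow> real \<Rightarrow> bool" where
  "stabilizing_riccati_solution A Bu Q P \<longleftrightarrow>
     P = A\<^sup>2 * P + Q - (lqr_gain A Bu P)\<^sup>2 * (1 + Bu\<^sup>2 * P) \<and>
     \<bar>A - Bu * lqr_gain A Bu P\<bar> < 1"

definition lqr_feedback ::
  "real \<Rightarrow> real \<Rightarrow> real \<Rightarrow> real \<Rightarrow> real \<Rightarrow> (signal \<Rightarrow> signal) \<Rightarrow> bool" where
  "lqr_feedback A Bu Bw Q P K \<longleftrightarrow>
     (\<forall>w\<in>l2. \<exists>x. state_trajectory A Bu Bw Q K w x \<and> (\<forall>t. K w t = - lqr_gain A Bu P * x t))"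

text \<open>
  On the optimal value: with \<open>T = B\<^sub>u\<^sup>2 P / Q\<close>, which solves the dual (filtering) Riccati
  equation \<open>T = A\<^sup>2 T + B\<^sub>u\<^sup>2 - A\<^sup>2 T\<^sup>2 / (Q\<^sup>-\<^sup>1 + T)\<close>, the optimal competitive ratio is
  \<open>1 + B\<^sub>u\<^sup>2 P\<^sup>2 (Q\<^sup>-\<^sup>1 + T) / (1 + B\<^sub>u\<^sup>2 P) = 1 + B\<^sub>u\<^sup>2 P\<^sup>2 / Q\<close>. The published formula has \<open>P\<close> in place
  of \<open>T\<close>. The two agree exactly if \<open>B\<^sub>u = 0\<close> or \<open>B\<^sub>u\<^sup>2 = Q\<close>; otherwise the published one is
  not the ratio (it is not invariant under rescaling of \<open>x\<close>, and for \<open>A = 0\<close>, \<open>B\<^sub>u = 1\<close>,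
  \<open>Q = 2\<close> it gives 13/3 whereas \<open>u = 0\<close> already achieves 3).
\<close>

end

theory Submission
  imports Defs
begin

text \<open>
  Write \<open>d = 1 + B\<^sub>u\<^sup>2 P\<close>, let \<open>a = A - B\<^sub>u K\<close> be the LQR closed-loop pole (\<open>K\<close> being the LQR gain), and let
  \<open>\<sigma>\<close> be the response of \<open>\<sigma>\<^sub>t\<^sub>+\<^sub>1 = a \<sigma>\<^sub>t + w\<^sub>t\<close> to the disturbance. The Riccati equation
  says \<open>A = a d\<close> and \<open>Q = P (1 - a\<^sup>2 d)\<close>, which gives the spectral factorization
  \<open>\<bar>z - A\<bar>\<^sup>2 + Q B\<^sub>u\<^sup>2 = d \<bar>1 - a z\<bar>\<^sup>2\<close> on the unit circle. Two costs follow.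

  \<^item> Under LQR feedback the state is \<open>B\<^sub>w \<sigma>\<close>, so the cost is a multiple of \<open>\<Sum>\<sigma>\<^sup>2\<close>, with
    factor \<open>P (1 - a\<^sup>2) B\<^sub>w\<^sup>2\<close> (\<open>cost_lqr\<close>).
  \<^item> The clairvoyant cost has the symbol
    \<open>\<bar>G\<bar>\<^sup>2 / (1 + \<bar>F\<bar>\<^sup>2) = (Q / d) B\<^sub>w\<^sup>2 / \<bar>1 - a z\<bar>\<^sup>2\<close>, and \<open>1 / \<bar>1 - a z\<bar>\<^sup>2\<close> is also the
    power spectrum of the filter \<open>w \<mapsto> \<sigma>\<close>, so this cost is \<open>(Q / d) B\<^sub>w\<^sup>2 \<Sum>\<sigma>\<^sup>2\<close>
    (\<open>cost_clairvoyant\<close>).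

  Hence LQR attains one and the same ratio \<open>P d (1 - a\<^sup>2) / Q\<close> on every nonzero disturbance.

  No strictly causal controller does better, and a single impulse at time \<open>0\<close> shows it.
  The controller cannot react before time \<open>1\<close>, when the state is already \<open>B\<^sub>w\<close>; from then
  on there is no disturbance, and the optimal cost-to-go from \<open>B\<^sub>w\<close> is \<open>P B\<^sub>w\<^sup>2\<close>
  (\<open>cost_impulse_ge\<close>). LQR pays exactly this, so on the impulse every controller
  has at least the ratio that LQR has everywhere (\<open>worst_case_ratio_ge\<close>).

  For \<open>\<bar>A\<bar> \<ge> 1\<close> the open-loop operators \<open>F\<close> and \<open>G\<close> are unbounded, so trajectories are
  found on disturbances that start at a finite time, where a solution of the state
  recursion is the output of the plant as soon as \<open>A\<^sup>n x\<^sub>t\<^sub>-\<^sub>n\<close> tends to \<open>0\<close>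
  (\<open>plant_op_add_eq\<close>), and then passed to the limit.
\<close>

section \<open>Square-summable signals\<close>

lemma l2_bounded:
  assumes "w \<in> l2"
  obtains C where "\<And>t. \<bar>w t\<bar> \<le> C"
proof -
  have s: "(\<lambda>t. (w t)\<^sup>2) summable_on UNIV"
    using assms by (simp add: l2_def)
  have "\<bar>w t\<bar> \<le> sqrt (\<Sum>\<^sub>\<infinity>t. (w t)\<^sup>2)" for t
  proof -
    have "(w t)\<^sup>2 \<le> (\<Sum>\<^sub>\<infinity>t. (w t)\<^sup>2)"
      using finite_sum_le_infsum[OF s, of "{t}"] by simp
    then show ?thesis
      using real_sqrt_le_mono[of "(w t)\<^sup>2"] by simp
  qed
  then show thesis by (rule that)
qed

lemma l2_start_at:
  assumes "w \<in> l2"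
  shows "start_at N w \<in> l2"
proof -
  have "(\<lambda>t. (start_at N w t)\<^sup>2) summable_on UNIV"
    by (rule summable_on_comparison_test[where f = "\<lambda>t. (w t)\<^sup>2"])
      (use assms in \<open>auto simp: l2_def start_at_def\<close>)
  then show ?thesis by (simp add: l2_def)
qed

lemma l2_reverse:
  assumes "w \<in> l2"
  shows "(\<lambda>t. w (c - t)) \<in> l2"
proof -
  have "(\<lambda>t. (w t)\<^sup>2) summable_on UNIV \<longleftrightarrow> (\<lambda>t. (w (c - t))\<^sup>2) summable_on UNIV"
    by (rule summable_on_reindex_bij_witness[where j = "\<lambda>t. c - t" and i = "\<lambda>t. c - t"]) auto
  then show ?thesis using assms by (simp add: l2_def)
qed

lemma l2_mult_summable:
  assumes "v \<in> l2" "w \<in> l2"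
  shows "(\<lambda>t. v t * w t) summable_on UNIV"
proof (rule abs_summable_summable, rule summable_on_comparison_test)
  show "(\<lambda>t. (v t)\<^sup>2 + (w t)\<^sup>2) summable_on UNIV"
    using assms by (intro summable_on_add) (auto simp: l2_def)
  show "norm (v t * w t) \<le> (v t)\<^sup>2 + (w t)\<^sup>2" for t
  proof -
    have "0 \<le> (\<bar>v t\<bar> - \<bar>w t\<bar>)\<^sup>2" by simp
    then have "2 * (\<bar>v t\<bar> * \<bar>w t\<bar>) \<le> (v t)\<^sup>2 + (w t)\<^sup>2"
      by (simp add: power2_diff)
    moreover have "0 \<le> \<bar>v t\<bar> * \<bar>w t\<bar>" by simp
    ultimately have "\<bar>v t\<bar> * \<bar>w t\<bar> \<le> (v t)\<^sup>2 + (w t)\<^sup>2" by linarith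
    then show ?thesis by (simp add: abs_mult)
  qed
qed auto

lemma infsum_shift: "(\<Sum>\<^sub>\<infinity>t. f (t + 1)) = (\<Sum>\<^sub>\<infinity>t. f t)"
  for f :: "int \<Rightarrow> 'a :: {comm_monoid_add, t2_space}"
  by (rule infsum_reindex_bij_witness[where j = "\<lambda>t. t + 1" and i = "\<lambda>t. t - 1"]) auto

lemma summable_shift: "(\<lambda>t. f (t + 1)) summable_on UNIV \<longleftrightarrow> f summable_on UNIV"
  for f :: "int \<Rightarrow> 'a :: {comm_monoid_add, t2_space}"
  by (rule summable_on_reindex_bij_witness[where j = "\<lambda>t. t + 1" and i = "\<lambda>t. t - 1"]) auto

lemma infsum_ennreal_eq:
  fixes f :: "'a \<Rightarrow> real"
  assumes "f summable_on UNIV" "\<And>t. 0 \<le> f t"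
  shows "(\<Sum>\<^sub>\<infinity>t. ennreal (f t)) = ennreal (\<Sum>\<^sub>\<infinity>t. f t)"
proof -
  have "((\<lambda>t. ennreal (f t)) has_sum ennreal (\<Sum>\<^sub>\<infinity>t. f t)) UNIV"
  proof -
    have "((\<lambda>F. ennreal (sum f F)) \<longlongrightarrow> ennreal (\<Sum>\<^sub>\<infinity>t. f t)) (finite_subsets_at_top UNIV)"
      using has_sum_infsum[OF assms(1)] by (intro tendsto_ennrealI) (simp add: has_sum_def)
    moreover have "sum (\<lambda>t. ennreal (f t)) = (\<lambda>F. ennreal (sum f F))"
      using assms(2) by (simp add: fun_eq_iff)
    ultimately show ?thesis by (simp add: has_sum_def)
  qed
  then show ?thesis by (rule infsumI)
qed


section \<open>First-order filters\<close>

text \<open>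
  \<open>fwd a\<close> and \<open>bwd a\<close> have the transfer functions \<open>z\<^sup>-\<^sup>1 / (1 - a z\<^sup>-\<^sup>1)\<close> and \<open>1 / (1 - a z)\<close>: a
  strictly causal filter, and an anticausal one that includes the present input. The
  operators with symbol \<open>1 / \<bar>1 - a z\<bar>\<^sup>2\<close> that occur below are combinations of the two.
\<close>

definition fwd :: "real \<Rightarrow> signal \<Rightarrow> signal" where
  "fwd a w t = (\<Sum>i. a ^ i * w (t - 1 - int i))"

definition bwd :: "real \<Rightarrow> signal \<Rightarrow> signal" where
  "bwd a w t = (\<Sum>i. a ^ i * w (t + int i))"

lemma bwd_conv_fwd: "bwd a w t = fwd a (\<lambda>s. w (0 - s)) (1 - t)"
  by (simp add: bwd_def fwd_def add.commute)

lemma summable_geometric_bounded: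
  fixes a :: real
  assumes "\<bar>a\<bar> < 1" "\<And>i. \<bar>f i\<bar> \<le> C"
  shows "summable (\<lambda>i. norm (a ^ i * f i))"
proof (rule summable_comparison_test')
  show "summable (\<lambda>i. \<bar>a\<bar> ^ i * C)"
    using assms(1) by (intro summable_mult2 summable_geometric) auto
  show "norm (norm (a ^ i * f i)) \<le> \<bar>a\<bar> ^ i * C" if "i \<ge> 0" for i
    using assms(2)[of i] by (simp add: abs_mult power_abs mult_left_mono)
qed

lemma summable_fwd:
  assumes "\<bar>a\<bar> < 1" "w \<in> l2"
  shows "summable (\<lambda>i. norm (a ^ i * w (t - 1 - int i)))"
    and "summable (\<lambda>i. a ^ i * w (t - 1 - int i))"
proof -
  obtain C where "\<And>t. \<bar>w t\<bar> \<le> C" using l2_bounded[OF assms(2)] by blast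
  then show "summable (\<lambda>i. norm (a ^ i * w (t - 1 - int i)))"
    by (intro summable_geometric_bounded assms)
  then show "summable (\<lambda>i. a ^ i * w (t - 1 - int i))"
    by (rule summable_norm_cancel)
qed

lemma summable_bwd:
  assumes "\<bar>a\<bar> < 1" "w \<in> l2"
  shows "summable (\<lambda>i. norm (a ^ i * w (t + int i)))"
proof -
  obtain C where "\<And>t. \<bar>w t\<bar> \<le> C" using l2_bounded[OF assms(2)] by blast
  then show ?thesis by (intro summable_geometric_bounded assms)
qed

lemma fwd_step:
  assumes "\<bar>a\<bar> < 1" "w \<in> l2"
  shows "fwd a w (t + 1) = a * fwd a w t + w t"
proof -
  have "fwd a w (t + 1) = (\<Sum>i. a ^ Suc i * w (t + 1 - 1 - int (Suc i))) + w t"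
    unfolding fwd_def using suminf_split_head[OF summable_fwd(2)[OF assms, of "t + 1"]] by simp
  also have "(\<lambda>i. a ^ Suc i * w (t + 1 - 1 - int (Suc i))) = (\<lambda>i. a * (a ^ i * w (t - 1 - int i)))"
    by (simp add: mult.assoc algebra_simps)
  finally show ?thesis
    using suminf_mult[OF summable_fwd(2)[OF assms, of t], of a] by (simp add: fwd_def)
qed

lemma bwd_step:
  assumes "\<bar>a\<bar> < 1" "w \<in> l2"
  shows "bwd a w t = w t + a * bwd a w (t + 1)"
  using fwd_step[OF assms(1) l2_reverse[OF assms(2)], of 0 "- t"]
  by (simp add: bwd_conv_fwd)

text \<open>
  Convexity of the square gives \<open>\<sigma>\<^sub>t\<^sub>+\<^sub>1\<^sup>2 \<le> \<bar>a\<bar> \<sigma>\<^sub>t\<^sup>2 + w\<^sub>t\<^sup>2 / (1 - \<bar>a\<bar>)\<close>. Summed over a window of time,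
  this bounds the energy of \<open>\<sigma>\<close> by that of \<open>w\<close> and one initial value; the initial values
  are bounded uniformly in time because \<open>w\<close> is.
\<close>

lemma fwd_l2:
  assumes a: "\<bar>a\<bar> < 1" and w: "w \<in> l2"
  shows "fwd a w \<in> l2"
proof -
  define s where "s t = (fwd a w t)\<^sup>2" for t
  define W where "W = (\<Sum>\<^sub>\<infinity>t. (w t)\<^sup>2)"
  have ws: "(\<lambda>t. (w t)\<^sup>2) summable_on UNIV" using w by (simp add: l2_def)
  obtain C where C: "\<And>t. \<bar>w t\<bar> \<le> C" using l2_bounded[OF w] by blast
  define M where "M = (C / (1 - \<bar>a\<bar>))\<^sup>2"
  have s_bound: "s t \<le> M" for t
  proof -
    have "\<bar>fwd a w t\<bar> \<le> (\<Sum>i. norm (a ^ i * w (t - 1 - int i)))"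
      unfolding fwd_def using summable_norm[OF summable_fwd(1)[OF a w]] by simp
    also have "\<dots> \<le> (\<Sum>i. \<bar>a\<bar> ^ i * C)"
      using a C by (intro suminf_le summable_fwd w summable_mult2 summable_geometric)
        (auto simp: abs_mult power_abs intro!: mult_left_mono)
    also have "\<dots> = C / (1 - \<bar>a\<bar>)"
      using a by (subst suminf_mult2[symmetric]) (auto simp: suminf_geometric)
    finally show ?thesis
      using power_mono[OF _ abs_ge_zero, of "fwd a w t" _ 2] by (simp add: s_def M_def)
  qed
  \<comment> \<open>\<open>a \<sigma>\<^sub>t + w\<^sub>t\<close> is a convex combination with weights \<open>1 - r = \<bar>a\<bar>\<close> and \<open>r\<close>, up to signs.\<close>
  have step: "s (t + 1) \<le> \<bar>a\<bar> * s t + (w t)\<^sup>2 / (1 - \<bar>a\<bar>)" for t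
  proof -
    define r where "r = 1 - \<bar>a\<bar>"
    define x where "x = \<bar>fwd a w t\<bar>"
    define y where "y = \<bar>w t\<bar> / r"
    have r: "0 < r" "\<bar>a\<bar> = 1 - r" using a by (auto simp: r_def)
    have "\<bar>fwd a w (t + 1)\<bar> \<le> \<bar>a\<bar> * x + r * y"
      using r by (simp add: fwd_step[OF a w] x_def y_def abs_mult
          order_trans[OF abs_triangle_ineq] del: r(2))
    then have "s (t + 1) \<le> (\<bar>a\<bar> * x + r * y)\<^sup>2"
      using power_mono[OF _ abs_ge_zero, of "fwd a w (t + 1)" _ 2] by (simp add: s_def)
    also have "\<dots> = \<bar>a\<bar> * x\<^sup>2 + r * y\<^sup>2 - \<bar>a\<bar> * r * (x - y)\<^sup>2"
      unfolding r(2) by (simp add: power2_eq_square algebra_simps)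
    also have "\<dots> \<le> \<bar>a\<bar> * x\<^sup>2 + r * y\<^sup>2"
      using r by simp
    also have "r * y\<^sup>2 = (w t)\<^sup>2 / r"
      using r(1) by (simp add: y_def power_divide power2_eq_square)
    finally show ?thesis by (simp add: s_def x_def r_def)
  qed
  have energy: "(1 - \<bar>a\<bar>) * (\<Sum>j<n. s (T + int j)) + s (T + int n)
                  \<le> s T + (\<Sum>j<n. (w (T + int j))\<^sup>2) / (1 - \<bar>a\<bar>)" for T n
  proof (induction n)
    case (Suc n)
    show ?case
      using Suc.IH step[of "T + int n"]
      by (simp add: algebra_simps add_divide_distrib)
  qed simp
  have "(\<lambda>t. s t) summable_on UNIV"
  proof (rule nonneg_bdd_above_summable_on)
    show "bdd_above (sum s ` {F. F \<subseteq> UNIV \<and> finite F})"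
    proof (rule bdd_aboveI2)
      fix F :: "int set"
      assume "F \<in> {F. F \<subseteq> UNIV \<and> finite F}"
      then have F: "finite F" by simp
      define T where "T = Min (insert 0 F)"
      define n where "n = nat (Max (insert 0 F) - T) + 1"
      have sub: "F \<subseteq> (\<lambda>j. T + int j) ` {..<n}"
      proof
        fix t assume "t \<in> F"
        then have "T \<le> t" "t \<le> Max (insert 0 F)" using F by (auto simp: T_def)
        then show "t \<in> (\<lambda>j. T + int j) ` {..<n}"
          by (intro image_eqI[of _ _ "nat (t - T)"]) (auto simp: n_def)
      qed
      have inj: "inj_on (\<lambda>j. T + int j) {..<n}" by (auto simp: inj_on_def)
      have "(\<Sum>j<n. (w (T + int j))\<^sup>2) = (\<Sum>t\<in>(\<lambda>j. T + int j) ` {..<n}. (w t)\<^sup>2)"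
        by (simp add: sum.reindex[OF inj])
      also have "\<dots> \<le> W"
        unfolding W_def by (rule finite_sum_le_infsum[OF ws]) auto
      finally have "(\<Sum>j<n. (w (T + int j))\<^sup>2) / (1 - \<bar>a\<bar>) \<le> W / (1 - \<bar>a\<bar>)"
        using a by (intro divide_right_mono) auto
      moreover have "0 \<le> s (T + int n)" by (simp add: s_def)
      ultimately have "(1 - \<bar>a\<bar>) * (\<Sum>j<n. s (T + int j)) \<le> M + W / (1 - \<bar>a\<bar>)"
        using energy[where T = T and n = n] s_bound[of T] by linarith
      then have "(\<Sum>j<n. s (T + int j)) \<le> (M + W / (1 - \<bar>a\<bar>)) / (1 - \<bar>a\<bar>)"
        using a by (simp add: pos_le_divide_eq mult.commute)
      moreover have "sum s F \<le> (\<Sum>j<n. s (T + int j))"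
      proof -
        have "sum s F \<le> sum s ((\<lambda>j. T + int j) ` {..<n})"
          by (rule sum_mono2[OF _ sub]) (auto simp: s_def)
        then show ?thesis by (simp add: sum.reindex[OF inj])
      qed
      ultimately show "sum s F \<le> (M + W / (1 - \<bar>a\<bar>)) / (1 - \<bar>a\<bar>)" by linarith
    qed
  qed (auto simp: s_def)
  then show ?thesis by (simp add: l2_def s_def)
qed

lemma bwd_l2:
  assumes "\<bar>a\<bar> < 1" "w \<in> l2"
  shows "bwd a w \<in> l2"
  using l2_reverse[OF fwd_l2[OF assms(1) l2_reverse[OF assms(2), of 0]], of 1]
  by (simp add: bwd_conv_fwd[abs_def])

text \<open>
  Both filters have the power spectrum \<open>1 / \<bar>1 - a z\<bar>\<^sup>2\<close>. In the time domain, let \<open>\<sigma>\<close> and \<open>m\<close> be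
  the two outputs and let a prime denote the next value. Then \<open>\<sigma>' - a \<sigma> = w = m - a m'\<close>,
  and squaring the rearrangement \<open>m + a \<sigma> = \<sigma>' + a m'\<close> relates the energies at adjacent
  times; the cross terms \<open>\<sigma> m\<close> and \<open>\<sigma>' m'\<close> have the same sum.
\<close>

lemma bwd_energy_eq_fwd_energy:
  assumes a: "\<bar>a\<bar> < 1" and w: "w \<in> l2"
  shows "(\<Sum>\<^sub>\<infinity>t. (bwd a w t)\<^sup>2) = (\<Sum>\<^sub>\<infinity>t. (fwd a w t)\<^sup>2)"
proof -
  define f where "f = fwd a w"
  define g where "g = bwd a w"
  define h where "h t = f t * g t" for t
  have f2: "(\<lambda>t. (f t)\<^sup>2) summable_on UNIV" and g2: "(\<lambda>t. (g t)\<^sup>2) summable_on UNIV"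
    using fwd_l2[OF a w] bwd_l2[OF a w] by (simp_all add: l2_def f_def g_def)
  have hs: "h summable_on UNIV"
    unfolding h_def f_def g_def by (intro l2_mult_summable fwd_l2 bwd_l2 a w)
  note shifted = f2[THEN summable_shift[THEN iffD2]] g2[THEN summable_shift[THEN iffD2]]
    hs[THEN summable_shift[THEN iffD2]]
  have pointwise: "(g t)\<^sup>2 + a\<^sup>2 * (f t)\<^sup>2 + 2 * a * h t
                    = (f (t + 1))\<^sup>2 + a\<^sup>2 * (g (t + 1))\<^sup>2 + 2 * a * h (t + 1)" for t
    using fwd_step[OF a w, of t] bwd_step[OF a w, of t]
    unfolding h_def f_def g_def by (simp add: power2_eq_square algebra_simps)
  have "(\<Sum>\<^sub>\<infinity>t. (g t)\<^sup>2) + a\<^sup>2 * (\<Sum>\<^sub>\<infinity>t. (f t)\<^sup>2) + 2 * a * (\<Sum>\<^sub>\<infinity>t. h t)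
        = (\<Sum>\<^sub>\<infinity>t. (g t)\<^sup>2 + a\<^sup>2 * (f t)\<^sup>2 + 2 * a * h t)"
    by (simp add: infsum_add summable_on_add summable_on_cmult_right f2 g2 hs infsum_cmult_right')
  also have "\<dots> = (\<Sum>\<^sub>\<infinity>t. (f (t + 1))\<^sup>2) + a\<^sup>2 * (\<Sum>\<^sub>\<infinity>t. (g (t + 1))\<^sup>2) + 2 * a * (\<Sum>\<^sub>\<infinity>t. h (t + 1))"
    unfolding pointwise
    by (simp add: infsum_add summable_on_add summable_on_cmult_right shifted infsum_cmult_right')
  also have "\<dots> = (\<Sum>\<^sub>\<infinity>t. (f t)\<^sup>2) + a\<^sup>2 * (\<Sum>\<^sub>\<infinity>t. (g t)\<^sup>2) + 2 * a * (\<Sum>\<^sub>\<infinity>t. h t)"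
    using infsum_shift[of "\<lambda>t. (f t)\<^sup>2"] infsum_shift[of "\<lambda>t. (g t)\<^sup>2"] infsum_shift[of h] by simp
  finally have "(1 - a\<^sup>2) * ((\<Sum>\<^sub>\<infinity>t. (g t)\<^sup>2) - (\<Sum>\<^sub>\<infinity>t. (f t)\<^sup>2)) = 0"
    by (simp add: algebra_simps)
  moreover have "a\<^sup>2 < 1" using a by (simp add: abs_square_less_1)
  ultimately show ?thesis by (simp add: f_def g_def)
qed

lemma fwd_energy_pos:
  assumes a: "\<bar>a\<bar> < 1"
    and w: "w \<in> l2 - {\<lambda>t. 0}"
  shows "0 < (\<Sum>\<^sub>\<infinity>t. (fwd a w t)\<^sup>2)"
proof -
  have wl: "w \<in> l2" using w by simp
  have s: "(\<lambda>t. (fwd a w t)\<^sup>2) summable_on UNIV"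
    using fwd_l2[OF a wl] by (simp add: l2_def)
  obtain t where t: "fwd a w t \<noteq> 0"
  proof (rule ccontr)
    assume "\<not> thesis"
    then have "fwd a w t = 0" for t using that by blast
    then have "w = (\<lambda>t. 0)" using fwd_step[OF a wl] by (simp add: fun_eq_iff)
    then show False using w by simp
  qed
  have "(fwd a w t)\<^sup>2 \<le> (\<Sum>\<^sub>\<infinity>t. (fwd a w t)\<^sup>2)"
    using finite_sum_le_infsum[OF s, of "{t}"] by simp
  moreover have "0 < (fwd a w t)\<^sup>2" using t by simp
  ultimately show ?thesis by linarith
qed

definition impulse :: signal where
  "impulse t = (if t = 0 then 1 else 0)"

lemma impulse_has_sum: "((\<lambda>t. (impulse t)\<^sup>2) has_sum 1) UNIV"
proof -
  have "((\<lambda>t. (impulse t)\<^sup>2) has_sum 1) {0}"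
    using has_sum_finite[of "{0::int}" "\<lambda>t. (impulse t)\<^sup>2"] by (simp add: impulse_def)
  then show ?thesis
    by (rule has_sum_cong_neutral[THEN iffD1, rotated -1]) (auto simp: impulse_def)
qed

lemma impulse_l2: "impulse \<in> l2"
  using impulse_has_sum by (auto simp: l2_def summable_on_def)

text \<open>
  The impulse hits a state that is \<open>0\<close>, so \<open>\<sigma>\<^sub>t\<^sub>+\<^sub>1\<^sup>2 = a\<^sup>2 \<sigma>\<^sub>t\<^sup>2 + w\<^sub>t\<^sup>2\<close> without a cross term, and
  summation over all times gives an equation for the energy.
\<close>

lemma impulse_energy:
  assumes a: "\<bar>a\<bar> < 1"
  shows "(\<Sum>\<^sub>\<infinity>t. (fwd a impulse t)\<^sup>2) = 1 / (1 - a\<^sup>2)"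
proof -
  define S where "S = (\<Sum>\<^sub>\<infinity>t. (fwd a impulse t)\<^sup>2)"
  have s: "(\<lambda>t. (fwd a impulse t)\<^sup>2) summable_on UNIV"
    using fwd_l2[OF a impulse_l2] by (simp add: l2_def)
  have "fwd a impulse 0 = 0" by (simp add: fwd_def impulse_def)
  then have "(fwd a impulse (t + 1))\<^sup>2 = a\<^sup>2 * (fwd a impulse t)\<^sup>2 + (impulse t)\<^sup>2" for t
    unfolding fwd_step[OF a impulse_l2]
    by (cases "t = 0") (simp_all add: impulse_def power_mult_distrib)
  then have "S = (\<Sum>\<^sub>\<infinity>t. a\<^sup>2 * (fwd a impulse t)\<^sup>2 + (impulse t)\<^sup>2)"
    using infsum_shift[of "\<lambda>t. (fwd a impulse t)\<^sup>2"] by (simp add: S_def)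
  also have "\<dots> = a\<^sup>2 * S + 1"
    unfolding S_def using impulse_has_sum
    by (simp add: infsum_add summable_on_cmult_right s infsum_cmult_right' infsumI has_sum_imp_summable)
  finally have "S * (1 - a\<^sup>2) = 1" by (simp add: algebra_simps)
  then show ?thesis using abs_square_less_1[of a] a by (simp add: S_def eq_divide_eq)
qed

lemma fwd_start_at_zero:
  assumes "t \<le> - int N"
  shows "fwd a (start_at N w) t = 0"
  using assms by (simp add: fwd_def start_at_def)

lemma fwd_start_at_tendsto:
  assumes "\<bar>a\<bar> < 1" "w \<in> l2"
  shows "(\<lambda>N. fwd a (start_at N w) t) \<longlonglongrightarrow> fwd a w t"
proof -
  have "fwd a (start_at N w) t = (\<Sum>i<nat (t + int N). a ^ i * w (t - 1 - int i))" for N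
    unfolding fwd_def
    by (subst suminf_finite[of "{..<nat (t + int N)}"]) (auto simp: start_at_def intro!: sum.cong)
  moreover have "filterlim (\<lambda>N. nat (t + int N)) at_top sequentially"
    unfolding filterlim_at_top
  proof
    fix Z :: nat
    show "\<forall>\<^sub>F N in sequentially. Z \<le> nat (t + int N)"
      using eventually_ge_at_top[of "nat (int Z - t)"] by eventually_elim linarith
  qed
  then have "(\<lambda>N. \<Sum>i<nat (t + int N). a ^ i * w (t - 1 - int i)) \<longlonglongrightarrow> fwd a w t"
    unfolding fwd_def
    by (rule filterlim_compose[OF summable_LIMSEQ[OF summable_fwd(2)[OF assms]]])
  ultimately show ?thesis by simp
qed

lemma bwd_start_at:
  assumes "- int N \<le> t"
  shows "bwd a (start_at N w) t = bwd a w t"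
  using assms by (simp add: bwd_def start_at_def)

text \<open>
  Before the input starts, an anticausal output decays geometrically into the past. This rate
  competes with the growth of \<open>A\<^sup>n\<close> in the trajectory of the clairvoyant controller.
\<close>

lemma bwd_start_at_before:
  assumes "\<bar>a\<bar> < 1" "w \<in> l2"
  shows "bwd a (start_at N w) (- int N - int n) = a ^ n * bwd a w (- int N)"
proof (induction n)
  case 0
  then show ?case by (simp add: bwd_start_at)
next
  case (Suc n)
  have "bwd a (start_at N w) (- int N - int (Suc n))
        = start_at N w (- int N - int (Suc n)) + a * bwd a (start_at N w) (- int N - int n)"
    by (subst bwd_step[OF assms(1) l2_start_at[OF assms(2)]]) (simp add: algebra_simps)
  moreover have "start_at N w (- int N - int (Suc n)) = 0" by (simp add: start_at_def)
  ultimately show ?case using Suc by simp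
qed


section \<open>State trajectories\<close>

text \<open>
  Unrolling the recursion \<open>n\<close> steps back leaves the remainder \<open>A\<^sup>n x\<^sub>t\<^sub>-\<^sub>n\<close>, so the two plant
  outputs together give \<open>x\<close> if it vanishes in the limit. The disturbance has to start at a
  finite time for its series, and hence that of the control, to converge separately.
\<close>

lemma plant_op_add_eq:
  assumes rec: "\<And>t. x (t + 1) = A * x t + B * u t + C * w t"
    and decay: "(\<lambda>n. A ^ n * x (t - int n)) \<longlonglongrightarrow> 0"
    and start: "\<And>s. s < T \<Longrightarrow> w s = 0"
  shows "plant_op A B Q u t + plant_op A C Q w t = sqrt Q * x t"
proof -
  define fu where "fu i = A ^ i * B * u (t - 1 - int i)" for i
  define fw where "fw i = A ^ i * C * w (t - 1 - int i)" for i
  have "(\<lambda>i. A ^ i * x (t - int i) - A ^ Suc i * x (t - int (Suc i))) sums (A ^ 0 * x (t - int 0) - 0)"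
    by (rule telescope_sums'[OF decay])
  moreover have "A ^ i * x (t - int i) - A ^ Suc i * x (t - int (Suc i)) = fu i + fw i" for i
    using rec[of "t - 1 - int i"] by (simp add: fu_def fw_def algebra_simps)
  ultimately have total: "(\<lambda>i. fu i + fw i) sums x t" by simp
  have "summable fw"
  proof (rule summable_finite[of "{..nat (t - T)}"])
    show "fw i = 0" if "i \<notin> {..nat (t - T)}" for i
      using that start[of "t - 1 - int i"] by (simp add: fw_def)
  qed simp
  moreover from this have "summable fu"
    using summable_diff[OF sums_summable[OF total], of fw] by simp
  ultimately have "suminf fu + suminf fw = x t"
    using total by (simp add: suminf_add sums_iff)
  moreover have "plant_op A B Q u t = sqrt Q * suminf fu" "plant_op A C Q w t = sqrt Q * suminf fw"
    unfolding plant_op_def fu_def fw_def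
    using suminf_mult[OF \<open>summable fu\<close>, of "sqrt Q", unfolded fu_def]
      suminf_mult[OF \<open>summable fw\<close>, of "sqrt Q", unfolded fw_def]
    by (simp_all add: mult.assoc)
  ultimately show ?thesis by (simp flip: distrib_left)
qed

lemma decay_of_finite_start:
  assumes "\<And>s. s \<le> T \<Longrightarrow> x s = (0::real)"
  shows "(\<lambda>n. A ^ n * x (t - int n)) \<longlonglongrightarrow> 0"
proof (rule tendsto_eventually)
  show "\<forall>\<^sub>F n in sequentially. A ^ n * x (t - int n) = 0"
    using eventually_ge_at_top[of "nat (t - T)"] by eventually_elim (simp add: assms)
qed

lemma cost_eq_of_state_trajectory:
  assumes "Q > 0" "state_trajectory A Bu Bw Q K w x"
  shows "cost A Bu Bw Q K w = (\<Sum>\<^sub>\<infinity>t. ennreal (Q * (x t)\<^sup>2 + (K w t)\<^sup>2))"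
proof -
  have "y = x" if "state_trajectory A Bu Bw Q K w y" for y
  proof
    fix t
    have "sqrt Q * y t = sqrt Q * x t"
      using assms(2) that unfolding state_trajectory_def by (blast intro: LIMSEQ_unique)
    then show "y t = x t" using assms(1) by simp
  qed
  then have "{x. state_trajectory A Bu Bw Q K w x} = {x}" using assms(2) by blast
  then show ?thesis by (simp add: cost_def)
qed

lemma strictly_causal_zero:
  assumes K: "K \<in> strictly_causal_controllers" and w: "w \<in> l2" and zero: "\<And>i. i < t \<Longrightarrow> w i = 0"
  shows "K w t = 0"
proof -
  have lin: "K (\<lambda>s. 0 * w s + 0 * w s) t = 0 * K w t + 0 * K w t"
    using K w unfolding strictly_causal_controllers_def by blast
  have z: "(\<lambda>t. 0) \<in> l2" by (simp add: l2_def)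
  have "K w t = K (\<lambda>t. 0) t"
    using K w z zero unfolding strictly_causal_controllers_def by fastforce
  then show ?thesis using lin by simp
qed


section \<open>Fourier coefficients of the Poisson kernel\<close>

lemma has_integral_cis_circle:
  "((\<lambda>\<theta>. cis (of_int n * \<theta>)) has_integral (if n = 0 then of_real (2 * pi) else 0)) {0..2 * pi}"
proof (cases "n = 0")
  case True
  then show ?thesis
    using has_integral_const_real[of "1::complex" 0 "2 * pi"] by (simp add: scaleR_conv_of_real)
next
  case False
  define F where "F \<theta> = exp (\<i> * of_int n * of_real \<theta>) / (\<i> * of_int n)" for \<theta> :: real
  have F_cis: "exp (\<i> * of_int n * of_real \<theta>) = cis (of_int n * \<theta>)" for \<theta>
    by (simp add: cis_conv_exp mult.assoc)
  have "(F has_vector_derivative cis (of_int n * \<theta>)) (at \<theta> within {0..2 * pi})" for \<theta>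
    unfolding F_def F_cis[symmetric]
  proof (rule has_vector_derivative_real_field)
    show "((\<lambda>z. exp (\<i> * of_int n * z) / (\<i> * of_int n)) has_field_derivative
            exp (\<i> * of_int n * of_real \<theta>)) (at (of_real \<theta>))"
      using False by (auto intro!: derivative_eq_intros)
  qed
  then have "((\<lambda>\<theta>. cis (of_int n * \<theta>)) has_integral (F (2 * pi) - F 0)) {0..2 * pi}"
    by (intro fundamental_theorem_of_calculus) auto
  moreover have "F (2 * pi) = F 0"
    unfolding F_def F_cis using cis_multiple_2pi[of "of_int n"] by (simp add: mult.commute)
  ultimately show ?thesis using False by simp
qed

lemma one_minus_mult_cis_bound:
  assumes "\<bar>a\<bar> < 1"
  shows "1 - \<bar>a\<bar> \<le> norm (1 - of_real a * cis \<theta>)" "1 - of_real a * cis \<theta> \<noteq> 0"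
proof -
  show bound: "1 - \<bar>a\<bar> \<le> norm (1 - of_real a * cis \<theta>)"
    using norm_triangle_ineq2[of 1 "of_real a * cis \<theta>"] by (simp add: norm_mult)
  then have "0 < norm (1 - of_real a * cis \<theta>)" using assms by linarith
  then show "1 - of_real a * cis \<theta> \<noteq> 0" by (rule zero_less_norm_iff[THEN iffD1])
qed

text \<open>
  These are the coefficients of \<open>1 / (1 - a z) = \<Sum>\<^sub>k a\<^sup>k z\<^sup>k\<close>. The kernel \<open>g\<close> satisfies
  \<open>g - a z g = 1\<close>, so the integrals \<open>h\<close> satisfy \<open>h\<^sub>n = a h\<^sub>n\<^sub>+\<^sub>1\<close> apart from an inhomogeneity at
  \<open>n = 0\<close>, and among the solutions only one is bounded.
\<close>

lemma has_integral_geometric_kernel: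
  assumes a: "\<bar>a\<bar> < 1"
  shows "((\<lambda>\<theta>. cis (of_int n * \<theta>) / (1 - of_real a * cis \<theta>)) has_integral
          (if n \<le> 0 then of_real (2 * pi * a ^ nat (- n)) else 0)) {0..2 * pi}"
proof -
  define g where "g n = (\<lambda>\<theta>. cis (of_int n * \<theta>) / (1 - of_real a * cis \<theta>))" for n :: int
  define h where "h n = integral {0..2 * pi} (g n)" for n
  have gh: "(g n has_integral h n) {0..2 * pi}" for n
  proof -
    have "g n integrable_on {0..2 * pi}"
      unfolding g_def using one_minus_mult_cis_bound(2)[OF a]
      by (intro integrable_continuous_real continuous_intros) auto
    then show ?thesis unfolding h_def by (rule integrable_integral)
  qed
  have step: "h n = of_real a * h (n + 1) + (if n = 0 then of_real (2 * pi) else 0)" for n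
  proof -
    have "g n \<theta> = of_real a * g (n + 1) \<theta> + cis (of_int n * \<theta>)" for \<theta>
    proof -
      have "cis (of_int (n + 1) * \<theta>) = cis (of_int n * \<theta>) * cis \<theta>"
        by (simp add: cis_mult distrib_right)
      then show ?thesis
        using one_minus_mult_cis_bound(2)[OF a, of \<theta>]
        by (simp add: g_def field_simps)
    qed
    then have "(g n has_integral of_real a * h (n + 1) + (if n = 0 then of_real (2 * pi) else 0))
                 {0..2 * pi}"
      using has_integral_add[OF has_integral_mult_right[OF gh] has_integral_cis_circle] by presburger
    then show ?thesis using gh has_integral_unique by blast
  qed
  have bounded: "norm (h n) \<le> 2 * pi / (1 - \<bar>a\<bar>)" for n
  proof -
    have "norm (h n) \<le> 1 / (1 - \<bar>a\<bar>) * measure lborel (cbox 0 (2 * pi))"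
    proof (rule has_integral_bound)
      show "(g n has_integral h n) (cbox 0 (2 * pi))" using gh by simp
      show "norm (g n \<theta>) \<le> 1 / (1 - \<bar>a\<bar>)" for \<theta>
        using one_minus_mult_cis_bound[OF a, of \<theta>] a
        by (auto simp: g_def norm_divide intro!: divide_left_mono mult_pos_pos)
    qed (use a in simp)
    then show ?thesis by simp
  qed
  \<comment> \<open>For positive indices the recursion only scales by \<open>a\<close>, and boundedness leaves only \<open>0\<close>.\<close>
  have pos: "h n = 0" if "0 < n" for n
  proof -
    have iter: "h n = of_real (a ^ k) * h (n + int k)" for k
    proof (induction k)
      case (Suc k)
      then show ?case using step[of "n + int k"] that by (simp add: algebra_simps)
    qed simp
    have "norm (h n) \<le> \<bar>a\<bar> ^ k * (2 * pi / (1 - \<bar>a\<bar>))" for k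
      using mult_left_mono[OF bounded, of "\<bar>a\<bar> ^ k" "n + int k"]
      by (subst iter[of k]) (simp add: norm_mult norm_power)
    moreover have "(\<lambda>k. \<bar>a\<bar> ^ k * (2 * pi / (1 - \<bar>a\<bar>))) \<longlonglongrightarrow> 0"
      using a by (intro tendsto_mult_left_zero LIMSEQ_power_zero) simp
    ultimately have "norm (h n) \<le> 0"
      by (intro LIMSEQ_le_const[of _ 0]) auto
    then show ?thesis by simp
  qed
  have nonpos: "h (- int k) = of_real (2 * pi * a ^ k)" for k
  proof (induction k)
    case 0
    show ?case using step[of 0] pos[of 1] by simp
  next
    case (Suc k)
    then show ?case using step[of "- int (Suc k)"] by simp
  qed
  have "h n = (if n \<le> 0 then of_real (2 * pi * a ^ nat (- n)) else 0)"
  proof (cases "0 < n")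
    case False
    then have "n = - int (nat (- n))" by simp
    then show ?thesis using False nonpos[of "nat (- n)"] by simp
  qed (simp add: pos)
  then show ?thesis using gh[of n] by (simp only: g_def)
qed

text \<open>
  The partial fraction
  \<open>(1 - a\<^sup>2) / \<bar>1 - a z\<bar>\<^sup>2 = 1 / (1 - a z) + 1 / (1 - a \<zeta>) - 1\<close>, with \<open>\<zeta>\<close> the conjugate of \<open>z\<close>,
  reduces the Poisson kernel to the geometric one. The finite set \<open>S\<close> accommodates a pole
  \<open>A = \<plusminus>1\<close> of the plant on the unit circle, where the symbol is given by the convention
  \<open>inverse 0 = 0\<close>.
\<close>

lemma laurent_coeff_poisson:
  assumes a: "\<bar>a\<bar> < 1"
    and f: "\<And>\<theta>. \<theta> \<in> {0..2 * pi} - S \<Longrightarrow> f (cis \<theta>) = of_real (c / (1 + a\<^sup>2 - 2 * a * cos \<theta>))"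
    and S: "finite S"
  shows "laurent_coeff f n = c / (1 - a\<^sup>2) * a ^ nat \<bar>n\<bar>"
proof -
  define K where "K \<theta> = 1 / (1 - of_real a * cis \<theta>)" for \<theta> :: real
  define I where "I m = (if m \<le> 0 then of_real (2 * pi * a ^ nat (- m)) else 0 :: complex)" for m :: int
  define C where "C = complex_of_real (c / (1 - a\<^sup>2))"
  have a2: "1 - a\<^sup>2 > 0" using a by (simp add: abs_square_less_1)
  have kernel: "of_real (c / (1 + a\<^sup>2 - 2 * a * cos \<theta>)) = C * (K \<theta> + cnj (K \<theta>) - 1)" for \<theta>
  proof -
    define z where "z = 1 - of_real a * cis \<theta>"
    have z: "z \<noteq> 0" using one_minus_mult_cis_bound(2)[OF a] by (simp add: z_def)
    have zz: "z * cnj z = of_real (1 + a\<^sup>2 - 2 * a * cos \<theta>)"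
    proof -
      have "(1 - a * cos \<theta>)\<^sup>2 + (a * sin \<theta>)\<^sup>2 = 1 - 2 * a * cos \<theta> + a\<^sup>2 * ((cos \<theta>)\<^sup>2 + (sin \<theta>)\<^sup>2)"
        by (simp only: power2_diff power_mult_distrib distrib_left) simp
      then have "(Re z)\<^sup>2 + (Im z)\<^sup>2 = 1 + a\<^sup>2 - 2 * a * cos \<theta>"
        by (simp add: z_def)
      then show ?thesis by (simp only: complex_mult_cnj)
    qed
    have zs: "z + cnj z = of_real (2 - 2 * a * cos \<theta>)"
      by (simp add: complex_eq_iff z_def)
    have "1 / z + cnj (1 / z) - 1 = (z + cnj z - z * cnj z) / (z * cnj z)"
      using z by (simp add: field_simps)
    also have "\<dots> = of_real ((1 - a\<^sup>2) / (1 + a\<^sup>2 - 2 * a * cos \<theta>))"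
      unfolding zz zs by (simp flip: of_real_diff of_real_divide)
    finally have "K \<theta> + cnj (K \<theta>) - 1 = of_real ((1 - a\<^sup>2) / (1 + a\<^sup>2 - 2 * a * cos \<theta>))"
      by (simp only: K_def z_def)
    moreover have "c / (1 + a\<^sup>2 - 2 * a * cos \<theta>)
        = c / (1 - a\<^sup>2) * ((1 - a\<^sup>2) / (1 + a\<^sup>2 - 2 * a * cos \<theta>))"
      using a2 by simp
    ultimately show ?thesis by (simp only: C_def of_real_mult)
  qed
  have i1: "((\<lambda>\<theta>. cis (of_int n * \<theta>) * K \<theta>) has_integral I n) {0..2 * pi}" for n
    using has_integral_geometric_kernel[OF a, of n] by (simp add: K_def I_def)
  have i2: "((\<lambda>\<theta>. cis (of_int n * \<theta>) * cnj (K \<theta>)) has_integral cnj (I (- n))) {0..2 * pi}"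
  proof -
    have "cnj \<circ> (\<lambda>\<theta>. cis (of_int (- n) * \<theta>) * K \<theta>) = (\<lambda>\<theta>. cis (of_int n * \<theta>) * cnj (K \<theta>))"
      by (simp add: fun_eq_iff cis_cnj)
    then show ?thesis
      using has_integral_cnj[THEN iffD2, OF i1[of "- n"]] by simp
  qed
  define J where "J = C * (I n + cnj (I (- n)) - (if n = 0 then of_real (2 * pi) else 0))"
  have "((\<lambda>\<theta>. C * (cis (of_int n * \<theta>) * K \<theta> + cis (of_int n * \<theta>) * cnj (K \<theta>)
            - cis (of_int n * \<theta>))) has_integral J) {0..2 * pi}"
    unfolding J_def
    by (intro has_integral_mult_right has_integral_diff has_integral_add i1 i2 has_integral_cis_circle)
  then have "((\<lambda>\<theta>. f (cis \<theta>) * cis (of_int n * \<theta>)) has_integral J) {0..2 * pi}"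
    by (rule has_integral_spike_finite[OF S, rotated]) (simp only: f kernel, simp add: algebra_simps)
  then have "laurent_coeff f n = Re J / (2 * pi)"
    unfolding laurent_coeff_def by (simp add: integral_unique)
  also have "I n + cnj (I (- n)) - (if n = 0 then of_real (2 * pi) else 0) = of_real (2 * pi * a ^ nat \<bar>n\<bar>)"
    by (simp add: I_def)
  then have "J = of_real (c / (1 - a\<^sup>2) * (2 * pi * a ^ nat \<bar>n\<bar>))"
    by (simp only: J_def C_def of_real_mult)
  then have "Re J / (2 * pi) = c / (1 - a\<^sup>2) * a ^ nat \<bar>n\<bar>"
    by (simp only: Re_complex_of_real) simp
  finally show ?thesis .
qed

lemma infsum_two_sided_geometric:
  assumes "\<bar>a\<bar> < 1" "w \<in> l2"
  shows "(\<Sum>\<^sub>\<infinity>s. c * a ^ nat \<bar>t - s\<bar> * w s) = c * (a * fwd a w t + bwd a w t)"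
proof -
  define f where "f s = c * a ^ nat \<bar>t - s\<bar> * w s" for s
  have "(f has_sum (c * a) * fwd a w t) ((\<lambda>i. t - 1 - int i) ` UNIV)"
  proof (subst has_sum_reindex)
    have "((\<lambda>i. (c * a) * (a ^ i * w (t - 1 - int i))) has_sum (c * a) * fwd a w t) UNIV"
      unfolding fwd_def
      by (intro has_sum_cmult_right norm_summable_imp_has_sum summable_sums summable_fwd assms)
    moreover have "nat \<bar>1 + int i\<bar> = Suc i" for i by simp
    ultimately show "(f \<circ> (\<lambda>i. t - 1 - int i) has_sum (c * a) * fwd a w t) UNIV"
      by (simp add: f_def o_def mult.assoc)
  qed (auto simp: inj_on_def)
  moreover have "(\<lambda>i. t - 1 - int i) ` UNIV = {..<t}"
  proof (intro set_eqI iffI)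
    fix s assume "s \<in> {..<t}"
    then show "s \<in> (\<lambda>i. t - 1 - int i) ` UNIV"
      by (intro image_eqI[of _ _ "nat (t - 1 - s)"]) auto
  qed auto
  moreover have "(f has_sum c * bwd a w t) ((\<lambda>i. t + int i) ` UNIV)"
  proof (subst has_sum_reindex)
    have "((\<lambda>i. c * (a ^ i * w (t + int i))) has_sum c * bwd a w t) UNIV"
      unfolding bwd_def
      by (intro has_sum_cmult_right norm_summable_imp_has_sum summable_sums summable_bwd
          summable_norm_cancel[OF summable_bwd] assms)
    then show "(f \<circ> (\<lambda>i. t + int i) has_sum c * bwd a w t) UNIV"
      by (simp add: f_def o_def mult.assoc)
  qed (auto simp: inj_on_def)
  moreover have "(\<lambda>i. t + int i) ` UNIV = {t..}"
  proof (intro set_eqI iffI)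
    fix s assume "s \<in> {t..}"
    then show "s \<in> (\<lambda>i. t + int i) ` UNIV"
      by (intro image_eqI[of _ _ "nat (s - t)"]) auto
  qed auto
  ultimately have "(f has_sum (c * a) * fwd a w t + c * bwd a w t) ({..<t} \<union> {t..})"
    by (intro has_sum_Un_disjoint) auto
  moreover have "{..<t} \<union> {t..} = UNIV" by auto
  ultimately show ?thesis
    unfolding f_def[symmetric] by (simp add: infsumI algebra_simps)
qed


section \<open>The Riccati solution\<close>

text \<open>
  The stabilizing Riccati solution in terms of the closed-loop pole \<open>a\<close>. All later
  computations are polynomial identities modulo the last three equations.
\<close>

locale riccati_plant =
  fixes A Bu Bw Q P a d :: real
  assumes Q_pos: "0 < Q"
    and P_pos: "0 < P"
    and Bw_nonzero: "Bw \<noteq> 0"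
    and a_bound: "\<bar>a\<bar> < 1"
    and d_eq: "d = 1 + Bu\<^sup>2 * P"
    and A_eq: "A = a * d"
    and Q_eq: "Q = P * (1 - a\<^sup>2 * d)"

text \<open>
  The closed-loop pole is \<open>a = A / d\<close>, which turns the Riccati equation into
  \<open>Q = P (1 - a\<^sup>2 d)\<close>. Positivity of \<open>P\<close> comes from stability: \<open>P \<le> 0\<close> would mean \<open>d \<le> 1\<close>,
  hence \<open>a\<^sup>2 d \<le> a\<^sup>2 < 1\<close>, and \<open>Q\<close> would not be positive.
\<close>

lemma riccati_plantI:
  assumes Q: "0 < Q" and Bw: "Bw \<noteq> 0" and P: "stabilizing_riccati_solution A Bu Q P"
  shows "riccati_plant A Bu Bw Q P (A - Bu * lqr_gain A Bu P) (1 + Bu\<^sup>2 * P)"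
proof -
  define d where "d = 1 + Bu\<^sup>2 * P"
  define a where "a = A - Bu * lqr_gain A Bu P"
  have a: "\<bar>a\<bar> < 1"
    and riccati: "P = A\<^sup>2 * P + Q - (lqr_gain A Bu P)\<^sup>2 * d"
    using P by (simp_all add: stabilizing_riccati_solution_def a_def d_def)
  have a2: "a\<^sup>2 < 1" using a by (simp add: abs_square_less_1)
  \<comment> \<open>If \<open>d = 0\<close>, the gain is \<open>0\<close> by \<open>inverse 0 = 0\<close>, and a stable plant with zero gain has \<open>P > 0\<close>.\<close>
  have d0: "d \<noteq> 0"
  proof
    assume d: "d = 0"
    then have gain: "lqr_gain A Bu P = 0" by (simp add: lqr_gain_def d_def)
    then have "P * (1 - a\<^sup>2) = Q" using riccati by (simp add: a_def algebra_simps)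
    then have "0 < P" using Q a2 by (metis diff_gt_0_iff_gt zero_less_mult_pos2)
    then have "0 < d" by (simp add: d_def add_pos_nonneg)
    then show False using d by simp
  qed
  have gain: "lqr_gain A Bu P * d = Bu * P * A"
    using d0 by (simp add: lqr_gain_def d_def)
  have ad: "a * d = A"
  proof -
    have "a * d = A * d - Bu * (lqr_gain A Bu P * d)" by (simp add: a_def algebra_simps)
    also have "\<dots> = A" unfolding gain by (simp add: d_def power2_eq_square algebra_simps)
    finally show ?thesis .
  qed
  have gain_a: "lqr_gain A Bu P = Bu * P * a"
  proof -
    have "lqr_gain A Bu P * d = Bu * P * a * d" unfolding gain by (simp flip: ad)
    then show ?thesis using d0 by simp
  qed
  have Q_eq: "Q = P * (1 - a\<^sup>2 * d)"
  proof -
    have "Q = P - A\<^sup>2 * P + (lqr_gain A Bu P)\<^sup>2 * d" using riccati by simp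
    also have "\<dots> = P - P * a\<^sup>2 * d * (d - Bu\<^sup>2 * P)"
      unfolding gain_a by (simp add: power2_eq_square algebra_simps flip: ad)
    also have "d - Bu\<^sup>2 * P = 1" by (simp add: d_def)
    finally show ?thesis by (simp add: algebra_simps)
  qed
  have "0 < P"
  proof (rule ccontr)
    assume "\<not> 0 < P"
    then have "Bu\<^sup>2 * P \<le> 0" by (simp add: mult_nonneg_nonpos)
    then have "d \<le> 1" by (simp add: d_def)
    then have "a\<^sup>2 * d \<le> a\<^sup>2" by (simp add: mult_left_le)
    then have "0 < 1 - a\<^sup>2 * d" using a2 by linarith
    then have "P * (1 - a\<^sup>2 * d) \<le> 0"
      using \<open>\<not> 0 < P\<close> by (simp add: mult_nonpos_nonneg)
    then show False using Q Q_eq by simp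
  qed
  then show ?thesis
    using Q Bw a Q_eq ad by unfold_locales (simp_all add: a_def d_def)
qed

context riccati_plant
begin

lemma d_ge_1: "1 \<le> d"
  using P_pos by (simp add: d_eq)

lemma a2_less_1: "a\<^sup>2 < 1"
  using a_bound by (simp add: abs_square_less_1)

lemma a2d_less_1: "a\<^sup>2 * d < 1"
proof -
  have "0 < P * (1 - a\<^sup>2 * d)" using Q_pos Q_eq by simp
  then show ?thesis using P_pos by (simp add: zero_less_mult_iff)
qed

lemma a_times_A: "a * A = a\<^sup>2 * d"
  by (simp add: A_eq power2_eq_square)

lemma Bu2_Q: "Bu\<^sup>2 * Q = (d - 1) * (1 - a\<^sup>2 * d)"
  by (simp add: Q_eq d_eq)

lemma lqr_gain_eq: "lqr_gain A Bu P = Bu * P * a"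
  using d_ge_1 by (simp add: lqr_gain_def A_eq flip: d_eq)

lemma closed_loop_eq: "A - Bu * (Bu * P * a) = a"
  by (simp add: A_eq d_eq power2_eq_square algebra_simps)


section \<open>The LQR controller\<close>

lemma lqr_state_step:
  assumes w: "w \<in> l2"
  shows "Bw * fwd a w (t + 1)
           = A * (Bw * fwd a w t) + Bu * (- lqr_gain A Bu P * (Bw * fwd a w t)) + Bw * w t"
proof -
  have feedback: "A * x + Bu * (- (Bu * P * a) * x) = a * x" for x
    using arg_cong[OF closed_loop_eq, of "\<lambda>b. b * x"] by (simp add: algebra_simps)
  show ?thesis
    unfolding lqr_gain_eq feedback fwd_step[OF a_bound w] by (simp add: algebra_simps)
qed

lemma lqr_response_start_at:
  assumes w: "w \<in> l2"
  shows "plant_op A Bu Q (\<lambda>t. - lqr_gain A Bu P * (Bw * fwd a (start_at N w) t)) t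
           + plant_op A Bw Q (start_at N w) t = sqrt Q * (Bw * fwd a (start_at N w) t)"
proof (rule plant_op_add_eq)
  show "Bw * fwd a (start_at N w) (t + 1) = A * (Bw * fwd a (start_at N w) t)
      + Bu * (- lqr_gain A Bu P * (Bw * fwd a (start_at N w) t)) + Bw * start_at N w t" for t
    by (rule lqr_state_step[OF l2_start_at[OF w]])
  show "(\<lambda>n. A ^ n * (Bw * fwd a (start_at N w) (t - int n))) \<longlonglongrightarrow> 0"
    by (rule decay_of_finite_start[where T = "- int N"]) (simp add: fwd_start_at_zero)
  show "start_at N w s = 0" if "s < - int N" for s
    using that by (simp add: start_at_def)
qed

lemma lqr_response_tendsto:
  assumes w: "w \<in> l2"
    and K: "\<And>N. K (start_at N w) = (\<lambda>t. - lqr_gain A Bu P * (Bw * fwd a (start_at N w) t))"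
  shows "(\<lambda>N. plant_op A Bu Q (K (start_at N w)) t + plant_op A Bw Q (start_at N w) t)
           \<longlonglongrightarrow> sqrt Q * (Bw * fwd a w t)"
  unfolding K lqr_response_start_at[OF w]
  by (intro tendsto_mult_left fwd_start_at_tendsto a_bound w)

definition lqr_controller :: "signal \<Rightarrow> signal" where
  "lqr_controller w t = - lqr_gain A Bu P * (Bw * fwd a w t)"

lemma lqr_controller_strictly_causal: "lqr_controller \<in> strictly_causal_controllers"
proof -
  have "fwd a (\<lambda>s. x * v s + y * w s) t = x * fwd a v t + y * fwd a w t"
    if "v \<in> l2" "w \<in> l2" for v w x y t
  proof -
    note sv = summable_fwd(2)[OF a_bound \<open>v \<in> l2\<close>, of t]
    note sw = summable_fwd(2)[OF a_bound \<open>w \<in> l2\<close>, of t]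
    have "x * fwd a v t + y * fwd a w t
          = (\<Sum>i. x * (a ^ i * v (t - 1 - int i)) + y * (a ^ i * w (t - 1 - int i)))"
      unfolding fwd_def using suminf_add[OF summable_mult[OF sv, of x] summable_mult[OF sw, of y]]
        suminf_mult[OF sv, of x] suminf_mult[OF sw, of y] by simp
    then show ?thesis by (simp add: fwd_def algebra_simps)
  qed
  moreover have "fwd a v t = fwd a w t" if "\<forall>i<t. v i = w i" for v w t
    using that by (simp add: fwd_def)
  ultimately show ?thesis
    by (auto simp: strictly_causal_controllers_def lqr_controller_def algebra_simps)
qed

lemma lqr_feedback_controller: "lqr_feedback A Bu Bw Q P lqr_controller"
  unfolding lqr_feedback_def
proof
  fix w :: signal
  assume w: "w \<in> l2"
  have "state_trajectory A Bu Bw Q lqr_controller w (\<lambda>t. Bw * fwd a w t)"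
    unfolding state_trajectory_def
  proof (intro conjI allI)
    show "Bw * fwd a w (t + 1) = A * (Bw * fwd a w t) + Bu * lqr_controller w t + Bw * w t" for t
      unfolding lqr_controller_def by (rule lqr_state_step[OF w])
    show "(\<lambda>N. plant_op A Bu Q (lqr_controller (start_at N w)) t + plant_op A Bw Q (start_at N w) t)
            \<longlonglongrightarrow> sqrt Q * (Bw * fwd a w t)" for t
      by (rule lqr_response_tendsto[OF w]) (simp add: fun_eq_iff lqr_controller_def)
  qed
  then show "\<exists>x. state_trajectory A Bu Bw Q lqr_controller w x
                  \<and> (\<forall>t. lqr_controller w t = - lqr_gain A Bu P * x t)"
    by (auto simp: lqr_controller_def)
qed

text \<open>
  The feedback law speaks of some state trajectory for each \<open>w\<close>, and the state recursion
  leaves a multiple of \<open>a\<^sup>t\<close> undetermined. For a disturbance starting at time \<open>-N\<close>, strict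
  causality makes the control vanish up to \<open>-N\<close>, which pins it down; the limit in the
  definition of the trajectory then transfers this to arbitrary disturbances.
\<close>

lemma lqr_feedback_response:
  assumes K: "K \<in> strictly_causal_controllers" and fb: "lqr_feedback A Bu Bw Q P K"
    and w: "w \<in> l2"
  shows "state_trajectory A Bu Bw Q K w (\<lambda>t. Bw * fwd a w t)"
    and "K w t = - lqr_gain A Bu P * (Bw * fwd a w t)"
proof -
  define k where "k = lqr_gain A Bu P"
  have K_start: "K (start_at N w) = (\<lambda>t. - k * (Bw * fwd a (start_at N w) t))" for N
  proof -
    define v where "v = start_at N w"
    have v: "v \<in> l2" unfolding v_def by (rule l2_start_at[OF w])
    obtain x where x: "state_trajectory A Bu Bw Q K v x" and Kx: "\<And>t. K v t = - k * x t"
      using fb v unfolding lqr_feedback_def k_def by blast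
    have before: "K v t = 0" if "t \<le> - int N" for t
      by (rule strictly_causal_zero[OF K v]) (use that in \<open>simp add: v_def start_at_def\<close>)
    \<comment> \<open>The control vanishes up to \<open>-N\<close>, but the state only if \<open>k \<noteq> 0\<close>; hence the factor \<open>k\<close>.\<close>
    have "k * x (- int N + int n) = k * (Bw * fwd a v (- int N + int n))" for n
    proof (induction n)
      case 0
      then show ?case using before[of "- int N"] Kx[of "- int N"]
        by (simp add: v_def fwd_start_at_zero)
    next
      case (Suc n)
      define t where "t = - int N + int n"
      have IH: "k * x t = k * (Bw * fwd a v t)" using Suc by (simp add: t_def)
      have "x (t + 1) = A * x t + Bu * (- k * x t) + Bw * v t"
        using x Kx by (simp add: state_trajectory_def)
      then have "k * x (t + 1) = k * (A * x t + Bu * (- k * x t) + Bw * v t)"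
        by (simp only:)
      also have "\<dots> = A * (k * x t) + Bu * (- k * (k * x t)) + k * Bw * v t"
        by (simp add: algebra_simps)
      also have "\<dots> = k * (Bw * fwd a v (t + 1))"
        unfolding IH lqr_state_step[OF v, of t, folded k_def] by (simp add: algebra_simps)
      finally show ?case by (simp add: t_def algebra_simps)
    qed
    note after = this
    have "K v t = - k * (Bw * fwd a v t)" for t
    proof (cases "t \<le> - int N")
      case True
      then show ?thesis using before by (simp add: v_def fwd_start_at_zero)
    next
      case False
      then show ?thesis using after[of "nat (t + int N)"] Kx[of t] by simp
    qed
    then show ?thesis by (simp add: fun_eq_iff v_def)
  qed
  obtain x where x: "state_trajectory A Bu Bw Q K w x" and Kx: "\<And>t. K w t = - k * x t"
    using fb w unfolding lqr_feedback_def k_def by blast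
  have "x t = Bw * fwd a w t" for t
  proof -
    have "(\<lambda>N. plant_op A Bu Q (K (start_at N w)) t + plant_op A Bw Q (start_at N w) t)
            \<longlonglongrightarrow> sqrt Q * x t"
      using x by (simp add: state_trajectory_def)
    moreover have "(\<lambda>N. plant_op A Bu Q (K (start_at N w)) t + plant_op A Bw Q (start_at N w) t)
            \<longlonglongrightarrow> sqrt Q * (Bw * fwd a w t)"
      by (rule lqr_response_tendsto[OF w K_start[unfolded k_def]])
    ultimately have "sqrt Q * x t = sqrt Q * (Bw * fwd a w t)"
      by (rule LIMSEQ_unique)
    then show ?thesis using Q_pos by simp
  qed
  then have "x = (\<lambda>t. Bw * fwd a w t)" by (simp add: fun_eq_iff)
  then show "state_trajectory A Bu Bw Q K w (\<lambda>t. Bw * fwd a w t)"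
    and "K w t = - lqr_gain A Bu P * (Bw * fwd a w t)"
    using x Kx by (simp_all add: k_def)
qed

lemma cost_lqr:
  assumes K: "K \<in> strictly_causal_controllers" and fb: "lqr_feedback A Bu Bw Q P K"
    and w: "w \<in> l2"
  shows "cost A Bu Bw Q K w = ennreal (P * (1 - a\<^sup>2) * Bw\<^sup>2 * (\<Sum>\<^sub>\<infinity>t. (fwd a w t)\<^sup>2))"
proof -
  have weight: "Q + (Bu * P * a)\<^sup>2 = P * (1 - a\<^sup>2)"
    by (simp add: Q_eq d_eq power2_eq_square algebra_simps)
  have f2: "(\<lambda>t. (fwd a w t)\<^sup>2) summable_on UNIV"
    using fwd_l2[OF a_bound w] by (simp add: l2_def)
  have "Q * (Bw * fwd a w t)\<^sup>2 + (K w t)\<^sup>2 = P * (1 - a\<^sup>2) * Bw\<^sup>2 * (fwd a w t)\<^sup>2" for t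
    unfolding lqr_feedback_response(2)[OF K fb w] lqr_gain_eq weight[symmetric]
    by (simp add: power2_eq_square algebra_simps)
  then have "cost A Bu Bw Q K w = (\<Sum>\<^sub>\<infinity>t. ennreal (P * (1 - a\<^sup>2) * Bw\<^sup>2 * (fwd a w t)\<^sup>2))"
    using cost_eq_of_state_trajectory[OF Q_pos lqr_feedback_response(1)[OF K fb w]] by simp
  also have "\<dots> = ennreal (\<Sum>\<^sub>\<infinity>t. P * (1 - a\<^sup>2) * Bw\<^sup>2 * (fwd a w t)\<^sup>2)"
    using f2 P_pos a2_less_1 by (intro infsum_ennreal_eq summable_on_cmult_right) auto
  finally show ?thesis by (simp add: infsum_cmult_right')
qed


section \<open>The clairvoyant controller\<close>

definition clairvoyant_scale :: real where
  "clairvoyant_scale = Bw / (d * (1 - a\<^sup>2))"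

lemma Bw_eq: "Bw = clairvoyant_scale * (d * (1 - a\<^sup>2))"
  using d_ge_1 a2_less_1 by (simp add: clairvoyant_scale_def)

text \<open>
  By the spectral factorization, the symbol of the clairvoyant controller is a multiple of the
  Poisson kernel.
\<close>

lemma clairvoyant_symbol:
  assumes "cis \<theta> \<noteq> of_real A"
  shows "- inverse (1 + cnj (plant_tf A Bu Q (cis \<theta>)) * plant_tf A Bu Q (cis \<theta>))
            * cnj (plant_tf A Bu Q (cis \<theta>)) * plant_tf A Bw Q (cis \<theta>)
         = of_real (- (Q * Bu * Bw / d) / (1 + a\<^sup>2 - 2 * a * cos \<theta>))"
proof -
  define y where "y = cis \<theta> - of_real A"
  define p where "p = (cmod y)\<^sup>2"
  have y0: "y \<noteq> 0" using assms by (simp add: y_def)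
  then have p0: "0 < p" by (simp add: p_def)
  have yy: "y * cnj y = of_real p" by (simp only: p_def complex_norm_square)
  have p_eq: "p = 1 + A\<^sup>2 - 2 * A * cos \<theta>"
  proof -
    have "p = (cos \<theta> - A)\<^sup>2 + (sin \<theta>)\<^sup>2" by (simp add: p_def cmod_power2 y_def)
    then show ?thesis using sin_cos_squared_add[of \<theta>] by (simp add: power2_diff)
  qed
  have factor: "p + Q * Bu\<^sup>2 = d * (1 + a\<^sup>2 - 2 * a * cos \<theta>)"
  proof -
    have "p + Q * Bu\<^sup>2 = 1 + A\<^sup>2 - 2 * A * cos \<theta> + Bu\<^sup>2 * Q" unfolding p_eq by simp
    also have "\<dots> = d * (1 + a\<^sup>2 - 2 * a * cos \<theta>)"
      unfolding Bu2_Q by (simp add: A_eq power2_eq_square algebra_simps)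
    finally show ?thesis .
  qed
  have sq: "complex_of_real (sqrt Q) * of_real (sqrt Q) = of_real Q"
    using Q_pos by (simp flip: of_real_mult)
  have FF: "cnj (plant_tf A Bu Q (cis \<theta>)) * plant_tf A B Q (cis \<theta>) = of_real (Q * Bu * B / p)" for B
  proof -
    have "cnj (plant_tf A Bu Q (cis \<theta>)) * plant_tf A B Q (cis \<theta>)
          = (of_real (sqrt Q) * of_real (sqrt Q)) * of_real Bu * of_real B / (y * cnj y)"
      by (simp add: plant_tf_def y_def divide_inverse)
    then show ?thesis unfolding sq yy by simp
  qed
  have "- inverse (1 + cnj (plant_tf A Bu Q (cis \<theta>)) * plant_tf A Bu Q (cis \<theta>))
            * cnj (plant_tf A Bu Q (cis \<theta>)) * plant_tf A Bw Q (cis \<theta>)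
        = - inverse (1 + of_real (Q * Bu * Bu / p)) * of_real (Q * Bu * Bw / p)"
    by (simp only: FF mult.assoc)
  also have "\<dots> = of_real (- inverse (1 + Q * Bu * Bu / p) * (Q * Bu * Bw / p))"
    by (simp only: of_real_mult of_real_minus of_real_inverse of_real_add of_real_1)
  also have "- inverse (1 + Q * Bu * Bu / p) * (Q * Bu * Bw / p) = - (Q * Bu * Bw) / (p + Q * Bu\<^sup>2)"
  proof -
    have "1 + Q * Bu * Bu / p = (p + Q * Bu\<^sup>2) / p"
      using p0 by (simp add: field_simps power2_eq_square)
    then show ?thesis using p0 by simp
  qed
  also have "\<dots> = - (Q * Bu * Bw / d) / (1 + a\<^sup>2 - 2 * a * cos \<theta>)"
    unfolding factor by simp
  finally show ?thesis .
qed

lemma clairvoyant_eq: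
  assumes w: "w \<in> l2"
  shows "clairvoyant A Bu Bw Q w t = - (Q * Bu * clairvoyant_scale) * (a * fwd a w t + bwd a w t)"
proof -
  have "laurent_coeff (\<lambda>z. - inverse (1 + cnj (plant_tf A Bu Q z) * plant_tf A Bu Q z)
                      * cnj (plant_tf A Bu Q z) * plant_tf A Bw Q z) n
        = - (Q * Bu * Bw / d) / (1 - a\<^sup>2) * a ^ nat \<bar>n\<bar>" for n
  proof (rule laurent_coeff_poisson[OF a_bound, where S = "{0, pi, 2 * pi}"])
    fix \<theta> assume \<theta>: "\<theta> \<in> {0..2 * pi} - {0, pi, 2 * pi}"
    then have "sin \<theta> \<noteq> 0"
      using sin_gt_zero[of \<theta>] sin_lt_zero[of \<theta>] by (cases "\<theta> < pi") force+
    then have "cis \<theta> \<noteq> of_real A" by (auto simp: complex_eq_iff)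
    then show "- inverse (1 + cnj (plant_tf A Bu Q (cis \<theta>)) * plant_tf A Bu Q (cis \<theta>))
            * cnj (plant_tf A Bu Q (cis \<theta>)) * plant_tf A Bw Q (cis \<theta>)
         = of_real (- (Q * Bu * Bw / d) / (1 + a\<^sup>2 - 2 * a * cos \<theta>))"
      by (rule clairvoyant_symbol)
  qed simp
  moreover have "- (Q * Bu * Bw / d) / (1 - a\<^sup>2) = - (Q * Bu * clairvoyant_scale)"
    by (simp add: clairvoyant_scale_def)
  ultimately show ?thesis
    unfolding clairvoyant_def laurent_op_def
    by (simp only: infsum_two_sided_geometric[OF a_bound w])
qed

text \<open>
  The symbol \<open>(I + F F\<^sup>*)\<^sup>-\<^sup>1 G\<close> of the optimal state is a multiple of
  \<open>(z\<^sup>-\<^sup>1 - A) / ((1 - a z) (1 - a z\<^sup>-\<^sup>1))\<close>; its partial fractions are the two filters with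
  numerators proportional to \<open>1 - a A\<close> and \<open>a - A\<close>.
\<close>

definition clairvoyant_state :: "signal \<Rightarrow> signal" where
  "clairvoyant_state w t = clairvoyant_scale * ((1 - a * A) * fwd a w t + (a - A) * bwd a w t)"

lemma clairvoyant_state_step:
  assumes w: "w \<in> l2"
  shows "clairvoyant_state w (t + 1)
           = A * clairvoyant_state w t + Bu * clairvoyant A Bu Bw Q w t + Bw * w t"
proof -
  define f where "f = fwd a w t"
  define g where "g = bwd a w t"
  have next_b: "(a - A) * bwd a w (t + 1) = (1 - d) * (g - w t)"
    using bwd_step[OF a_bound w, of t] by (simp add: A_eq g_def algebra_simps)
  have lhs: "clairvoyant_state w (t + 1)
             = clairvoyant_scale * ((1 - a\<^sup>2 * d) * (a * f + w t) + (1 - d) * (g - w t))"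
    unfolding clairvoyant_state_def next_b by (simp add: fwd_step[OF a_bound w] f_def a_times_A)
  have disturbance: "Bw * w t = clairvoyant_scale * (d * (1 - a\<^sup>2)) * w t"
    using arg_cong[OF Bw_eq, of "\<lambda>b. b * w t"] .
  have "A * clairvoyant_state w t + Bu * clairvoyant A Bu Bw Q w t + Bw * w t
        = clairvoyant_scale * (a * d * ((1 - a\<^sup>2 * d) * f + (a - a * d) * g)
            - (Bu\<^sup>2 * Q) * (a * f + g) + d * (1 - a\<^sup>2) * w t)"
    unfolding clairvoyant_state_def clairvoyant_eq[OF w] a_times_A f_def[symmetric] g_def[symmetric]
      disturbance
    by (simp add: A_eq power2_eq_square algebra_simps)
  also have "\<dots> = clairvoyant_state w (t + 1)"
    unfolding lhs Bu2_Q by (simp add: power2_eq_square algebra_simps)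
  finally show ?thesis ..
qed

text \<open>
  Into the past the control and the state decay like \<open>a\<^sup>n\<close>, and \<open>\<bar>A a\<bar> = a\<^sup>2 d < 1\<close>, so the
  plant series converges even when \<open>\<bar>A\<bar> \<ge> 1\<close>.
\<close>

lemma clairvoyant_response_start_at:
  assumes w: "w \<in> l2"
  shows "plant_op A Bu Q (clairvoyant A Bu Bw Q (start_at N w)) t + plant_op A Bw Q (start_at N w) t
           = sqrt Q * clairvoyant_state (start_at N w) t"
proof (rule plant_op_add_eq)
  show "clairvoyant_state (start_at N w) (t + 1) = A * clairvoyant_state (start_at N w) t
      + Bu * clairvoyant A Bu Bw Q (start_at N w) t + Bw * start_at N w t" for t
    by (rule clairvoyant_state_step[OF l2_start_at[OF w]])
  show "start_at N w s = 0" if "s < - int N" for s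
    using that by (simp add: start_at_def)
  \<comment> \<open>After \<open>m\<close> steps back from \<open>t\<close> the forward output has vanished and only the tail of
    the backward one remains.\<close>
  define m where "m = nat (t + int N)"
  define C where "C = A ^ m * clairvoyant_scale * (a - A) * a ^ nat (int m - t - int N) * bwd a w (- int N)"
  have shifted: "A ^ (n + m) * clairvoyant_state (start_at N w) (t - int (n + m)) = C * (a * A) ^ n" for n
  proof -
    define j where "j = nat (int m - t - int N)"
    have t: "t - int (n + m) = - int N - int (n + j)"
      by (simp add: j_def m_def)
    show ?thesis
      unfolding t clairvoyant_state_def bwd_start_at_before[OF a_bound w]
      by (simp add: fwd_start_at_zero C_def j_def power_add power_mult_distrib)
  qed
  have "(\<lambda>n. C * (a * A) ^ n) \<longlonglongrightarrow> 0"
    using a2d_less_1 d_ge_1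
    by (intro tendsto_mult_right_zero LIMSEQ_power_zero) (simp add: a_times_A)
  then have "(\<lambda>n. A ^ (n + m) * clairvoyant_state (start_at N w) (t - int (n + m))) \<longlonglongrightarrow> 0"
    unfolding shifted .
  then show "(\<lambda>n. A ^ n * clairvoyant_state (start_at N w) (t - int n)) \<longlonglongrightarrow> 0"
    by (rule LIMSEQ_offset)
qed

lemma state_trajectory_clairvoyant:
  assumes w: "w \<in> l2"
  shows "state_trajectory A Bu Bw Q (clairvoyant A Bu Bw Q) w (clairvoyant_state w)"
  unfolding state_trajectory_def clairvoyant_response_start_at[OF w]
proof (intro conjI allI)
  show "clairvoyant_state w (t + 1)
           = A * clairvoyant_state w t + Bu * clairvoyant A Bu Bw Q w t + Bw * w t" for t
    by (rule clairvoyant_state_step[OF w])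
  show "(\<lambda>N. sqrt Q * clairvoyant_state (start_at N w) t) \<longlonglongrightarrow> sqrt Q * clairvoyant_state w t" for t
  proof -
    have "(\<lambda>N. bwd a (start_at N w) t) \<longlonglongrightarrow> bwd a w t"
    proof (rule tendsto_eventually)
      show "\<forall>\<^sub>F N in sequentially. bwd a (start_at N w) t = bwd a w t"
        using eventually_ge_at_top[of "nat (- t)"] by eventually_elim (simp add: bwd_start_at)
    qed
    then show ?thesis
      unfolding clairvoyant_state_def
      by (intro tendsto_mult_left tendsto_add fwd_start_at_tendsto a_bound w)
  qed
qed

text \<open>
  In the stage cost, written with the outputs \<open>\<sigma>\<close> and \<open>m\<close> of the two filters, the mixed terms
  \<open>\<sigma> m\<close> of the state and the control cancel. What is left beyond \<open>(Q / d) B\<^sub>w\<^sup>2 \<sigma>\<^sup>2\<close> is a multiple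
  of \<open>m\<^sup>2 - \<sigma>\<^sup>2\<close>, which sums to zero because the filters have equal energy.
\<close>

lemma cost_clairvoyant:
  assumes w: "w \<in> l2"
  shows "cost A Bu Bw Q (clairvoyant A Bu Bw Q) w
           = ennreal (Q / d * Bw\<^sup>2 * (\<Sum>\<^sub>\<infinity>t. (fwd a w t)\<^sup>2))"
proof -
  define u where "u = clairvoyant A Bu Bw Q w"
  define x where "x = clairvoyant_state w"
  define p where "p = Q / d * Bw\<^sup>2"
  define q where "q = Q * clairvoyant_scale\<^sup>2 * (1 - a\<^sup>2) * (d - 1)"
  define f where "f = fwd a w"
  define g where "g = bwd a w"
  have f2: "(\<lambda>t. (f t)\<^sup>2) summable_on UNIV" and g2: "(\<lambda>t. (g t)\<^sup>2) summable_on UNIV"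
    using fwd_l2[OF a_bound w] bwd_l2[OF a_bound w] by (simp_all add: l2_def f_def g_def)
  have p_eq: "p = Q * clairvoyant_scale\<^sup>2 * (d * (1 - a\<^sup>2)\<^sup>2)"
    using d_ge_1 by (simp add: p_def, subst Bw_eq) (simp add: power2_eq_square)
  have stage: "Q * (x t)\<^sup>2 + (u t)\<^sup>2 = (p - q) * (f t)\<^sup>2 + q * (g t)\<^sup>2" for t
  proof -
    have "Q * (x t)\<^sup>2 + (u t)\<^sup>2 = Q * clairvoyant_scale\<^sup>2 *
        (((1 - a\<^sup>2 * d) * f t + (a - a * d) * g t)\<^sup>2 + (Bu\<^sup>2 * Q) * (a * f t + g t)\<^sup>2)"
      unfolding x_def u_def clairvoyant_state_def clairvoyant_eq[OF w] a_times_A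
        f_def[symmetric] g_def[symmetric]
      by (simp add: A_eq power2_eq_square algebra_simps)
    also have "\<dots> = Q * clairvoyant_scale\<^sup>2 *
        (d * (1 - a\<^sup>2)\<^sup>2 * (f t)\<^sup>2 + (1 - a\<^sup>2) * (d - 1) * ((g t)\<^sup>2 - (f t)\<^sup>2))"
      unfolding Bu2_Q by (simp add: power2_eq_square algebra_simps)
    finally show ?thesis by (simp add: p_eq q_def algebra_simps)
  qed
  have "cost A Bu Bw Q (clairvoyant A Bu Bw Q) w = (\<Sum>\<^sub>\<infinity>t. ennreal (Q * (x t)\<^sup>2 + (u t)\<^sup>2))"
    unfolding x_def u_def
    by (rule cost_eq_of_state_trajectory[OF Q_pos state_trajectory_clairvoyant[OF w]])
  also have "\<dots> = ennreal (\<Sum>\<^sub>\<infinity>t. Q * (x t)\<^sup>2 + (u t)\<^sup>2)"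
  proof (rule infsum_ennreal_eq)
    show "(\<lambda>t. Q * (x t)\<^sup>2 + (u t)\<^sup>2) summable_on UNIV"
      unfolding stage by (intro summable_on_add summable_on_cmult_right f2 g2)
  qed (use Q_pos in simp)
  also have "(\<Sum>\<^sub>\<infinity>t. Q * (x t)\<^sup>2 + (u t)\<^sup>2)
             = (p - q) * (\<Sum>\<^sub>\<infinity>t. (f t)\<^sup>2) + q * (\<Sum>\<^sub>\<infinity>t. (g t)\<^sup>2)"
    unfolding stage
    by (simp add: infsum_add infsum_cmult_right' summable_on_cmult_right f2 g2)
  also have "\<dots> = p * (\<Sum>\<^sub>\<infinity>t. (f t)\<^sup>2)"
    using bwd_energy_eq_fwd_energy[OF a_bound w] by (simp add: f_def g_def algebra_simps)
  finally show ?thesis by (simp add: p_def f_def)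
qed


section \<open>Lower bound from the impulse disturbance\<close>

text \<open>
  Completing the square in the Bellman equation: the slack is \<open>d (u + K x)\<^sup>2\<close> with the LQR gain
  \<open>K\<close>.
\<close>

lemma stage_cost_ge_value_decrease: "P * x\<^sup>2 \<le> Q * x\<^sup>2 + u\<^sup>2 + P * (A * x + Bu * u)\<^sup>2"
proof -
  have "Q * x\<^sup>2 + u\<^sup>2 + P * (A * x + Bu * u)\<^sup>2 - P * x\<^sup>2 = d * (u + Bu * P * a * x)\<^sup>2"
    by (simp add: Q_eq A_eq d_eq power2_eq_square algebra_simps)
  also have "0 \<le> \<dots>" using d_ge_1 by simp
  finally show ?thesis by simp
qed

text \<open>
  The terminal value \<open>P x\<^sub>T\<^sup>2\<close> of a finite horizon drops out: if the total cost is finite, then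
  \<open>Q > 0\<close> forces the state to \<open>0\<close>.
\<close>

lemma cost_to_go_ge:
  fixes x u :: signal
  assumes rec: "\<And>t. t \<ge> T \<Longrightarrow> x (t + 1) = A * x t + Bu * u t"
  shows "ennreal (P * (x T)\<^sup>2) \<le> (\<Sum>\<^sub>\<infinity>t. ennreal (Q * (x t)\<^sup>2 + (u t)\<^sup>2))"
proof (cases "(\<Sum>\<^sub>\<infinity>t. ennreal (Q * (x t)\<^sup>2 + (u t)\<^sup>2))" rule: ennreal_cases)
  case (real r)
  define f where "f t = Q * (x t)\<^sup>2 + (u t)\<^sup>2" for t
  have f_nonneg: "0 \<le> f t" for t using Q_pos by (simp add: f_def)
  have partial: "(\<Sum>j<n. f (T + int j)) \<le> r" for n
  proof -
    have inj: "inj_on (\<lambda>j. T + int j) {..<n}" by (auto simp: inj_on_def)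
    have "(\<Sum>t\<in>(\<lambda>j. T + int j) ` {..<n}. ennreal (f t)) \<le> (\<Sum>\<^sub>\<infinity>t. ennreal (f t))"
      unfolding nonneg_infsum_complete[of UNIV "\<lambda>t. ennreal (f t)", OF zero_le]
      by (intro SUP_upper) simp
    then have "ennreal (\<Sum>j<n. f (T + int j)) \<le> ennreal r"
      using f_nonneg real by (simp add: sum.reindex[OF inj] f_def[symmetric])
    then show ?thesis using real by (simp add: ennreal_le_iff)
  qed
  have telescope: "P * (x T)\<^sup>2 \<le> (\<Sum>j<n. f (T + int j)) + P * (x (T + int n))\<^sup>2" for n
  proof (induction n)
    case (Suc n)
    have "x (T + int (Suc n)) = A * x (T + int n) + Bu * u (T + int n)"
      using rec[of "T + int n"] by (simp add: algebra_simps)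
    then show ?case
      using Suc stage_cost_ge_value_decrease[of "x (T + int n)" "u (T + int n)"]
      by (simp add: f_def)
  qed simp
  have "(\<lambda>j. f (T + int j)) \<longlonglongrightarrow> 0"
    by (intro summable_LIMSEQ_zero summableI_nonneg_bounded[OF _ partial] f_nonneg)
  then have "(\<lambda>n. r + P * (f (T + int n) / Q)) \<longlonglongrightarrow> r + P * (0 / Q)"
    by (intro tendsto_intros) (use Q_pos in auto)
  moreover have "P * (x T)\<^sup>2 \<le> r + P * (f (T + int n) / Q)" for n
  proof -
    have "(x (T + int n))\<^sup>2 \<le> f (T + int n) / Q"
      using Q_pos by (simp add: f_def field_simps)
    then have "P * (x (T + int n))\<^sup>2 \<le> P * (f (T + int n) / Q)"
      using P_pos by (intro mult_left_mono) auto
    then show ?thesis using telescope[of n] partial[of n] by linarith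
  qed
  ultimately have "P * (x T)\<^sup>2 \<le> r"
    by (intro LIMSEQ_le_const[of _ "r + P * (0 / Q)" "P * (x T)\<^sup>2", simplified]) auto
  then show ?thesis using real by (simp add: ennreal_leI)
qed simp

text \<open>
  The controller is idle up to time \<open>0\<close>, so the impulse moves the state from \<open>0\<close> to \<open>B\<^sub>w\<close>
  uncontrolled. That the state is \<open>0\<close> at time \<open>0\<close> comes from the input-output form of the
  trajectory, as the recursion alone does not exclude a past.
\<close>

lemma cost_impulse_ge:
  assumes K: "K \<in> strictly_causal_controllers"
  shows "ennreal (P * Bw\<^sup>2) \<le> cost A Bu Bw Q K impulse"
  unfolding cost_def
proof (rule INF_greatest)
  fix x assume "x \<in> {x. state_trajectory A Bu Bw Q K impulse x}"
  then have x: "state_trajectory A Bu Bw Q K impulse x" by simp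
  have K0: "K impulse t = 0" if "t \<le> 0" for t
    by (rule strictly_causal_zero[OF K impulse_l2]) (use that in \<open>simp add: impulse_def\<close>)
  have "start_at N impulse = impulse" for N
    by (simp add: start_at_def impulse_def fun_eq_iff)
  then have "(\<lambda>N. plant_op A Bu Q (K impulse) 0 + plant_op A Bw Q impulse 0)
               \<longlonglongrightarrow> sqrt Q * x 0"
    using x by (simp add: state_trajectory_def)
  moreover have "plant_op A Bu Q (K impulse) 0 = 0" "plant_op A Bw Q impulse 0 = 0"
    by (simp_all add: plant_op_def K0 impulse_def)
  ultimately have "sqrt Q * x 0 = 0" by (simp add: LIMSEQ_const_iff)
  then have x0: "x 0 = 0" using Q_pos by simp
  have step: "x (t + 1) = A * x t + Bu * K impulse t + Bw * impulse t" for t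
    using x by (simp add: state_trajectory_def)
  have "x 1 = Bw" using step[of 0] by (simp add: x0 K0 impulse_def)
  moreover have "ennreal (P * (x 1)\<^sup>2) \<le> (\<Sum>\<^sub>\<infinity>t. ennreal (Q * (x t)\<^sup>2 + (K impulse t)\<^sup>2))"
    by (rule cost_to_go_ge) (simp add: step impulse_def)
  ultimately show "ennreal (P * Bw\<^sup>2) \<le> (\<Sum>\<^sub>\<infinity>t. ennreal (Q * (x t)\<^sup>2 + (K impulse t)\<^sup>2))"
    by simp
qed


section \<open>The optimal competitive ratio\<close>

definition optimal_ratio :: real where
  "optimal_ratio = P * d * (1 - a\<^sup>2) / Q"

lemma optimal_ratio_eq: "optimal_ratio = 1 + Bu\<^sup>2 * P\<^sup>2 * (inverse Q + Bu\<^sup>2 * P / Q) / (1 + Bu\<^sup>2 * P)"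
proof -
  have "P * d * (1 - a\<^sup>2) = Q + Bu\<^sup>2 * P\<^sup>2"
    by (simp add: Q_eq d_eq power2_eq_square algebra_simps)
  then have "optimal_ratio = 1 + Bu\<^sup>2 * P\<^sup>2 / Q"
    using Q_pos by (simp add: optimal_ratio_def add_divide_distrib)
  moreover have "inverse Q + Bu\<^sup>2 * P / Q = d / Q"
    by (simp add: d_eq add_divide_distrib inverse_eq_divide)
  ultimately show ?thesis
    using d_ge_1 by (simp flip: d_eq)
qed

text \<open>
  Both costs are multiples of the same energy \<open>\<Sum>\<sigma>\<^sup>2\<close>, which cancels.
\<close>

lemma lqr_ratio_constant:
  assumes K: "K \<in> strictly_causal_controllers" and fb: "lqr_feedback A Bu Bw Q P K"
    and w: "w \<in> l2 - {\<lambda>t. 0}"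
  shows "cost A Bu Bw Q K w / cost A Bu Bw Q (clairvoyant A Bu Bw Q) w = ennreal optimal_ratio"
proof -
  define S where "S = (\<Sum>\<^sub>\<infinity>t. (fwd a w t)\<^sup>2)"
  have S: "0 < S" unfolding S_def by (rule fwd_energy_pos[OF a_bound w])
  have wl: "w \<in> l2" using w by simp
  have "cost A Bu Bw Q K w / cost A Bu Bw Q (clairvoyant A Bu Bw Q) w
        = ennreal (P * (1 - a\<^sup>2) * Bw\<^sup>2 * S / (Q / d * Bw\<^sup>2 * S))"
    unfolding cost_lqr[OF K fb wl] cost_clairvoyant[OF wl] S_def[symmetric]
    using S Q_pos P_pos d_ge_1 a2_less_1 Bw_nonzero by (intro divide_ennreal) auto
  also have "P * (1 - a\<^sup>2) * Bw\<^sup>2 * S / (Q / d * Bw\<^sup>2 * S) = optimal_ratio"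
    using S Bw_nonzero d_ge_1 by (simp add: optimal_ratio_def)
  finally show ?thesis .
qed

lemma worst_case_ratio_ge:
  assumes K: "K \<in> strictly_causal_controllers"
  shows "ennreal optimal_ratio \<le> worst_case_ratio A Bu Bw Q K"
proof -
  have nonzero: "impulse \<in> l2 - {\<lambda>t. 0}"
    using impulse_l2 by (auto simp: impulse_def fun_eq_iff)
  have "optimal_ratio = P * Bw\<^sup>2 / (Q / d * Bw\<^sup>2 * (1 / (1 - a\<^sup>2)))"
    using Bw_nonzero d_ge_1 a2_less_1 by (simp add: optimal_ratio_def)
  then have "ennreal optimal_ratio = ennreal (P * Bw\<^sup>2) / cost A Bu Bw Q (clairvoyant A Bu Bw Q) impulse"
    unfolding cost_clairvoyant[OF impulse_l2] impulse_energy[OF a_bound]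
    using P_pos Q_pos Bw_nonzero d_ge_1 a2_less_1 by (simp only:, subst divide_ennreal) auto
  also have "\<dots> \<le> cost A Bu Bw Q K impulse / cost A Bu Bw Q (clairvoyant A Bu Bw Q) impulse"
    by (intro divide_right_mono_ennreal cost_impulse_ge K)
  also have "\<dots> \<le> worst_case_ratio A Bu Bw Q K"
    unfolding worst_case_ratio_def by (rule SUP_upper[OF nonzero])
  finally show ?thesis .
qed

lemma worst_case_ratio_lqr:
  assumes "K \<in> strictly_causal_controllers" "lqr_feedback A Bu Bw Q P K"
  shows "worst_case_ratio A Bu Bw Q K = ennreal optimal_ratio"
proof (rule antisym)
  show "worst_case_ratio A Bu Bw Q K \<le> ennreal optimal_ratio"
    unfolding worst_case_ratio_def
    by (rule SUP_least) (simp only: lqr_ratio_constant[OF assms] order.refl)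
qed (rule worst_case_ratio_ge[OF assms(1)])

lemma comp_ratio_eq: "comp_ratio A Bu Bw Q = ennreal optimal_ratio"
proof (rule antisym)
  show "comp_ratio A Bu Bw Q \<le> ennreal optimal_ratio"
    unfolding comp_ratio_def
    using INF_lower[OF lqr_controller_strictly_causal, of "worst_case_ratio A Bu Bw Q"]
    by (simp add: worst_case_ratio_lqr[OF lqr_controller_strictly_causal lqr_feedback_controller])
  show "ennreal optimal_ratio \<le> comp_ratio A Bu Bw Q"
    unfolding comp_ratio_def by (rule INF_greatest) (rule worst_case_ratio_ge)
qed

end

theorem theorem3:
  fixes A Bu Bw Q P :: real
  assumes "Q > 0"
    and "stabilizable A Bu"
    and "Bw \<noteq> 0"
    and "stabilizing_riccati_solution A Bu Q P"
  shows "comp_ratio A Bu Bw Q =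
           ennreal (1 + Bu\<^sup>2 * P\<^sup>2 * (inverse Q + Bu\<^sup>2 * P / Q) / (1 + Bu\<^sup>2 * P)) \<and>
         (\<exists>K\<in>strictly_causal_controllers. lqr_feedback A Bu Bw Q P K) \<and>
         (\<forall>K\<in>strictly_causal_controllers. lqr_feedback A Bu Bw Q P K \<longrightarrow>
           worst_case_ratio A Bu Bw Q K = comp_ratio A Bu Bw Q)"
proof -
  interpret riccati_plant A Bu Bw Q P "A - Bu * lqr_gain A Bu P" "1 + Bu\<^sup>2 * P"
    using assms by (intro riccati_plantI)
  show ?thesis
    unfolding optimal_ratio_eq[symmetric]
    using comp_ratio_eq lqr_controller_strictly_causal lqr_feedback_controller worst_case_ratio_lqr
    by auto
qed

end
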